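(* There exists an absolute constant $c>0$ such that for every positive integer $n$, \[\operatorname{herdisc}(\mathcal A_n)\le c\,\phi(n)^{1/2}\left(\log\frac{en}{\phi(n)}\right)^{3/2}.\]
   Context: An arithmetic progression in $\mathbb{Z}_n$ is a set $\{a+kd: 0\le k<l\}$ with $a,d\in\mathbb{Z}_n$ and $l$ an integer with $0\le l\le n/\gcd(n,d)$ (with $\gcd(0,n)=n$); $\mathcal A_n$ is the family of all of them. For $X\subseteq\mathbb{Z}_n$ and $\chi:X\to\{1,-1\}$, $\chi(B)=\sum_{x\in B}\chi(x)$ for $B\subseteq X$; $\operatorname{disc}(\mathcal A_n|_X)=\min_{\chi:X\to\{1,-1\}}\max_{A\in\mathcal A_n}|\chi(A\cap X)|$, and $\operatorname{herdisc}(\mathcal A_n)=\max_{X\subseteq\mathbb{Z}_n}\operatorname{disc}(\mathcal A_n|_X)$. $\phi$ is Euler's totient function; logarithms are natural. *)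

theory Defs
  imports "HOL-Analysis.Analysis" "HOL-Number_Theory.Number_Theory"
begin

definition Zn :: "nat \<Rightarrow> nat set" where
  "Zn n = {0..<n}"

definition arith_prog :: "nat \<Rightarrow> nat \<Rightarrow> nat \<Rightarrow> nat \<Rightarrow> nat set" where
  "arith_prog n a d l = {(a + k * d) mod n | k. k < l}"

text \<open>Family of all arithmetic progressions in Z_n; note gcd n 0 = n.\<close>
definition APs :: "nat \<Rightarrow> nat set set" where
  "APs n = {arith_prog n a d l | a d l. a \<in> Zn n \<and> d \<in> Zn n \<and> l \<le> n div gcd n d}"

definition colourings :: "nat set \<Rightarrow> (nat \<Rightarrow> int) set" where
  "colourings X = {f. (\<forall>x\<in>X. f x \<in> {1, -1}) \<and> (\<forall>x. x \<notin> X \<longrightarrow> f x = 0)}"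

definition disc_restr :: "nat \<Rightarrow> nat set \<Rightarrow> int" where
  "disc_restr n X = Min ((\<lambda>f. Max ((\<lambda>A. \<bar>\<Sum>x\<in>A \<inter> X. f x\<bar>) ` APs n)) ` colourings X)"

definition herdisc_AP :: "nat \<Rightarrow> int" where
  "herdisc_AP n = Max (disc_restr n ` Pow (Zn n))"

end

theory Submission
  imports Defs
begin

text \<open>
  The colouring is built by iterated partial colouring. Write L = log(en/phi(n)). For every step d,
  list the points of X on each orbit of x \<mapsto> x + d and cut the list into dyadic blocks; an arithmetic
  progression is a combination of at most three prefixes, and a prefix uses at most one block of each
  size s. The number of d whose orbits have length at least s is
  O(phi(n) log(en/s)), because phi(n/g) \<le> phi(n)/phi(g) and the sum of 1/phi(g) over g \<le> G is
  O(1 + log G); so there are O(card X phi(n) log(en/s)/s) blocks of size s. By the entropy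
  argument, a partial colouring of a constant fraction of X exists whose discrepancy on the blocks
  decays geometrically as s moves away from the critical size T of order phi(n) L. It has
  discrepancy O(sqrt T min(1, (card X/T)^(1/4))) on all progressions. Of the rounds needed, only
  O(L) start with more than T points, and the later ones contribute a geometric series, so the total
  is O(sqrt T L) = O(sqrt(phi(n)) L^(3/2)).
\<close>

section \<open>Partial colouring by the entropy argument\<close>

text \<open>Since \<open>X\<close> is arbitrary, a round must be paid for by the points of
  \<open>X\<close> alone: the entropy of all rounded block sums has to stay below
  \<open>card X / 4\<close>. Then the colourings that share all rounded sums outnumber a Hamming
  ball of radius \<open>card X / 16\<close>, and half the difference of two distant ones is a
  partial colouring. At block size s = T / 2^j there may be about 4^j blocks per point: a factor 2^j
  from the shorter blocks and another that absorbs the growing logarithm. There the rounding step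
  must exceed the standard deviation sqrt s, and the excess 2^(j/4) is a compromise: Gaussian tails
  push the entropy per block below 8^(-j), while the step sqrt s * 2^(j/4) = sqrt T * 2^(-j/4) still
  sums to O(sqrt T). Above T blocks are rare, so steps far below the standard deviation are
  affordable at a price of j + O(1) per block. With y = (card X / T)^(1/4), the minimum of 1 and y
  is replaced by y / (1 + y), the derivative of ln (1 + y) with respect to ln y. The whole iteration
  then telescopes into one logarithm, with no separation of large and small rounds.\<close>

text \<open>A set A encodes the colouring that is 1 on A and -1 off A, so that colourings of X are counted
  by Pow X and the Hamming distance is the size of the symmetric difference.\<close>

definition signed_sum :: "'a set \<Rightarrow> 'a set \<Rightarrow> real" where
  "signed_sum A S = (\<Sum>x\<in>S. if x \<in> A then 1 else -1)"

text \<open>Termwise comparison of the power series, by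
  \<open>2 ^ n * fact n \<le> fact (2 * n)\<close>. It says that a random sign is subgaussian with
  variance 1.\<close>

lemma cosh_le_exp_half_square: "cosh (x::real) \<le> exp (x\<^sup>2 / 2)"
proof -
  have fact_bound: "2 ^ n * fact n \<le> (fact (2 * n) :: real)" for n
  proof (induction n)
    case (Suc n)
    have "2 ^ Suc n * fact (Suc n) = (2 * real (Suc n)) * (2 ^ n * fact n :: real)"
      by simp
    also have "\<dots> \<le> (2 * real (Suc n)) * fact (2 * n)"
      using Suc.IH by (intro mult_left_mono) auto
    also have "\<dots> \<le> ((2 * real n + 2) * (2 * real n + 1)) * fact (2 * n)"
      by (intro mult_right_mono) (auto simp: algebra_simps)
    also have "\<dots> = fact (2 * Suc n)"
      by (simp add: algebra_simps)
    finally show ?case .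
  qed simp
  have c: "(\<lambda>n. if even n then x ^ n /\<^sub>R fact n else 0) sums cosh x"
    by (rule cosh_converges)
  have inj: "strict_mono (\<lambda>n::nat. 2 * n)"
    by (auto simp: strict_mono_def)
  have z: "(if even n then x ^ n /\<^sub>R fact n else 0) = 0" if "n \<notin> range (\<lambda>n. 2 * n)" for n
    using that by (auto elim!: evenE)
  have s1: "(\<lambda>n. x ^ (2 * n) / fact (2 * n)) sums cosh x"
    using sums_mono_reindex[OF inj, of "\<lambda>n. if even n then x ^ n /\<^sub>R fact n else 0" "cosh x"] c z
    by (simp add: divide_inverse mult.commute)
  have s2: "(\<lambda>n. (x\<^sup>2 / 2) ^ n /\<^sub>R fact n) sums exp (x\<^sup>2 / 2)"
    by (rule exp_converges)
  have "x ^ (2 * n) / fact (2 * n) \<le> (x\<^sup>2 / 2) ^ n /\<^sub>R fact n" for n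
  proof -
    have "x ^ (2 * n) / fact (2 * n) \<le> x ^ (2 * n) / (2 ^ n * fact n)"
      using fact_bound[of n] by (intro divide_left_mono) auto
    then show ?thesis
      by (simp only: power_mult power_divide real_scaleR_def) (simp add: field_simps)
  qed
  then show ?thesis
    using s1 s2 by (rule sums_le)
qed

text \<open>Up to the factor \<open>2 ^ card X\<close> this is the moment generating function of a
  sum of random signs. Each \<open>A\<close> picks the factor \<open>f\<close> on \<open>A\<close>
  and \<open>g\<close> off \<open>A\<close>, so the sum over \<open>A\<close> expands a product over
  the points.\<close>

lemma sum_Pow_exp_signed_sum:
  fixes \<theta> :: real
  assumes "finite X" "S \<subseteq> X"
  shows "(\<Sum>A\<in>Pow X. exp (\<theta> * signed_sum A S)) = 2 ^ card X * cosh \<theta> ^ card S"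
proof -
  define f where "f = (\<lambda>x. if x \<in> S then exp \<theta> else 1)"
  define g where "g = (\<lambda>x. if x \<in> S then exp (-\<theta>) else 1)"
  have fin: "finite S" using assms finite_subset by blast
  have "exp (\<theta> * signed_sum A S) = (\<Prod>x\<in>A. f x) * (\<Prod>x\<in>X - A. g x)" if A: "A \<subseteq> X" for A
  proof -
    have "exp (\<theta> * signed_sum A S) = (\<Prod>x\<in>S. if x \<in> A then exp \<theta> else exp (-\<theta>))"
      unfolding signed_sum_def sum_distrib_left exp_sum[OF fin] by (intro prod.cong) auto
    also have "\<dots> = (\<Prod>x\<in>X. if x \<in> A then f x else g x)"
      using assms fin by (intro prod.mono_neutral_cong_left) (auto simp: f_def g_def)
    also have "\<dots> = (\<Prod>x\<in>A. f x) * (\<Prod>x\<in>X - A. g x)"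
      using prod.If_cases[OF assms(1), of "\<lambda>x. x \<in> A" f g] A
      by (simp add: Int_absorb1 Diff_eq)
    finally show ?thesis .
  qed
  then have "(\<Sum>A\<in>Pow X. exp (\<theta> * signed_sum A S)) = (\<Prod>x\<in>X. f x + g x)"
    by (subst prod_add[OF assms(1)]) (auto intro!: sum.cong)
  also have "\<dots> = (\<Prod>x\<in>X. 2 * (if x \<in> S then cosh \<theta> else 1))"
    by (intro prod.cong) (auto simp: f_def g_def cosh_def)
  also have "\<dots> = 2 ^ card X * (\<Prod>x\<in>X. if x \<in> S then cosh \<theta> else 1)"
    by (simp add: prod.distrib)
  also have "(\<Prod>x\<in>X. if x \<in> S then cosh \<theta> else 1) = cosh \<theta> ^ card S"
    using assms by (subst prod.If_cases) (auto simp: Int_absorb1)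
  finally show ?thesis .
qed

text \<open>Working with \<open>cosh\<close> controls both tails of the random sum at once.\<close>

lemma sum_Pow_cosh_signed_sum_le:
  fixes \<theta> :: real
  assumes "finite X" "S \<subseteq> X"
  shows "(\<Sum>A\<in>Pow X. cosh (\<theta> * signed_sum A S)) \<le> 2 ^ card X * exp (\<theta>\<^sup>2 * card S / 2)"
proof -
  have "(\<Sum>A\<in>Pow X. cosh (\<theta> * signed_sum A S))
      = ((\<Sum>A\<in>Pow X. exp (\<theta> * signed_sum A S)) + (\<Sum>A\<in>Pow X. exp ((-\<theta>) * signed_sum A S))) / 2"
    by (simp add: cosh_def sum.distrib[symmetric] sum_divide_distrib)
  also have "\<dots> = 2 ^ card X * cosh \<theta> ^ card S"
    unfolding sum_Pow_exp_signed_sum[OF assms] by simp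
  also have "\<dots> \<le> 2 ^ card X * exp (\<theta>\<^sup>2 / 2) ^ card S"
    by (intro mult_left_mono power_mono cosh_le_exp_half_square) auto
  also have "\<dots> = 2 ^ card X * exp (\<theta>\<^sup>2 * card S / 2)"
    by (simp add: exp_of_nat_mult[symmetric] mult_ac)
  finally show ?thesis .
qed

text \<open>Gibbs' inequality replaces subadditivity of entropy: the weights q i need not be the true
  marginal distributions, which leaves them free to be chosen explicitly.\<close>

lemma ex_large_fibre:
  fixes v :: "'i \<Rightarrow> 'a \<Rightarrow> 'b" and q :: "'i \<Rightarrow> 'b \<Rightarrow> real" and h :: real
  assumes fin: "finite \<Omega>" "\<Omega> \<noteq> {}" "finite I"
    and q_pos: "\<And>i k. i \<in> I \<Longrightarrow> q i k > 0"
    and q_sum: "\<And>i F. i \<in> I \<Longrightarrow> finite F \<Longrightarrow> (\<Sum>k\<in>F. q i k) \<le> 1"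
    and cost: "(\<Sum>i\<in>I. \<Sum>\<omega>\<in>\<Omega>. - ln (q i (v i \<omega>))) \<le> card \<Omega> * h"
  shows "\<exists>\<omega>\<in>\<Omega>. card \<Omega> * exp (- h) \<le> card {\<omega>'\<in>\<Omega>. \<forall>i\<in>I. v i \<omega>' = v i \<omega>}"
proof (rule ccontr)
  \<comment> \<open>\<open>V \<omega>\<close> is the vector of all codes, \<open>c \<omega>\<close>
    the size of its fibre, and \<open>Q\<close> a product weight of total mass at most 1.\<close>
  define V where "V = (\<lambda>\<omega>. restrict (\<lambda>i. v i \<omega>) I)"
  define c where "c = (\<lambda>\<omega>. card {\<omega>'\<in>\<Omega>. V \<omega>' = V \<omega>})"
  define Q where "Q = (\<lambda>w. \<Prod>i\<in>I. q i (w i))"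
  let ?N = "real (card \<Omega>)"
  have N: "?N > 0" using fin by (simp add: card_gt_0_iff)
  have Veq: "V \<omega>' = V \<omega> \<longleftrightarrow> (\<forall>i\<in>I. v i \<omega>' = v i \<omega>)" for \<omega> \<omega>'
    by (auto simp: V_def restrict_def fun_eq_iff)
  have cpos: "c \<omega> > 0" if "\<omega> \<in> \<Omega>" for \<omega>
    using that fin by (auto simp: c_def card_gt_0_iff)
  have Qpos: "Q w > 0" for w
    unfolding Q_def by (intro prod_pos) (auto intro: q_pos)
  have lnQ: "ln (Q (V \<omega>)) = (\<Sum>i\<in>I. ln (q i (v i \<omega>)))" for \<omega>
  proof -
    have "ln (Q (V \<omega>)) = (\<Sum>i\<in>I. ln (q i (V \<omega> i)))"
      unfolding Q_def using fin q_pos by (intro ln_prod) (auto simp: less_imp_neq[THEN not_sym])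
    then show ?thesis by (simp add: V_def)
  qed
  \<comment> \<open>The \<open>c \<omega>\<close> members of a fibre share the weight of their
    common vector, so the sum collapses to the mass of \<open>Q\<close> on the attained
    vectors.\<close>
  have "(\<Sum>\<omega>\<in>\<Omega>. Q (V \<omega>) / c \<omega>) = (\<Sum>w\<in>V ` \<Omega>. \<Sum>\<omega>\<in>{\<omega>\<in>\<Omega>. V \<omega> = w}. Q (V \<omega>) / c \<omega>)"
    by (rule sum.image_gen) fact
  also have "\<dots> = (\<Sum>w\<in>V ` \<Omega>. Q w)"
  proof (rule sum.cong[OF refl])
    fix w assume "w \<in> V ` \<Omega>"
    then obtain \<omega>0 where \<omega>0: "\<omega>0 \<in> \<Omega>" "w = V \<omega>0" by auto
    have "(\<Sum>\<omega>\<in>{\<omega>\<in>\<Omega>. V \<omega> = w}. Q (V \<omega>) / c \<omega>) = (\<Sum>\<omega>\<in>{\<omega>\<in>\<Omega>. V \<omega> = w}. Q w / c \<omega>0)"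
      by (rule sum.cong) (auto simp: c_def \<omega>0)
    also have "\<dots> = Q w"
      using cpos[OF \<omega>0(1)] by (simp add: c_def \<omega>0)
    finally show "(\<Sum>\<omega>\<in>{\<omega>\<in>\<Omega>. V \<omega> = w}. Q (V \<omega>) / c \<omega>) = Q w" .
  qed
  also have "\<dots> \<le> (\<Sum>w\<in>PiE I (\<lambda>i. v i ` \<Omega>). Q w)"
    using fin Qpos by (intro sum_mono2 finite_PiE) (auto simp: V_def less_imp_le)
  also have "\<dots> = (\<Prod>i\<in>I. \<Sum>k\<in>v i ` \<Omega>. q i k)"
    unfolding Q_def using fin by (intro prod_sum_PiE[symmetric]) auto
  also have "\<dots> \<le> (\<Prod>i\<in>I. 1)"
    using fin q_pos q_sum by (intro prod_mono conjI sum_nonneg) (auto simp: less_imp_le)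
  finally have le1: "(\<Sum>\<omega>\<in>\<Omega>. Q (V \<omega>) / c \<omega>) \<le> 1" by simp
  \<comment> \<open>Gibbs' inequality: \<open>ln t \<le> t - 1\<close>, where t is the ratio of the
    weight \<open>Q\<close> to the true probability \<open>c \<omega> / ?N\<close> of the
    vector.\<close>
  have "(\<Sum>\<omega>\<in>\<Omega>. ln ?N + ln (Q (V \<omega>)) - ln (c \<omega>)) \<le> (\<Sum>\<omega>\<in>\<Omega>. ?N * (Q (V \<omega>) / c \<omega>) - 1)"
  proof (rule sum_mono)
    fix \<omega> assume \<omega>: "\<omega> \<in> \<Omega>"
    have "ln ?N + ln (Q (V \<omega>)) - ln (c \<omega>) = ln (?N * (Q (V \<omega>) / c \<omega>))"
      using N Qpos[of "V \<omega>"] cpos[OF \<omega>] by (simp add: ln_mult ln_div)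
    also have "\<dots> \<le> ?N * (Q (V \<omega>) / c \<omega>) - 1"
      using N Qpos[of "V \<omega>"] cpos[OF \<omega>] by (intro ln_le_minus_one) simp
    finally show "ln ?N + ln (Q (V \<omega>)) - ln (c \<omega>) \<le> ?N * (Q (V \<omega>) / c \<omega>) - 1" .
  qed
  also have "\<dots> = ?N * (\<Sum>\<omega>\<in>\<Omega>. Q (V \<omega>) / c \<omega>) - ?N"
    by (simp add: sum_subtractf sum_distrib_left)
  also have "\<dots> \<le> 0"
    using le1 N by (simp add: mult_le_cancel_left1)
  finally have A: "(\<Sum>\<omega>\<in>\<Omega>. ln ?N + ln (Q (V \<omega>)) - ln (c \<omega>)) \<le> 0" .
  \<comment> \<open>If all fibres were too small, the mean of \<open>ln (c \<omega>)\<close> would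
    lie below \<open>ln ?N - h\<close>, against the Gibbs bound combined with
    \<open>cost\<close>.\<close>
  assume "\<not> ?thesis"
  then have small: "c \<omega> < ?N * exp (- h)" if "\<omega> \<in> \<Omega>" for \<omega>
    using that by (auto simp: c_def Veq not_le)
  have "(\<Sum>\<omega>\<in>\<Omega>. ln (c \<omega>)) < (\<Sum>\<omega>\<in>\<Omega>. ln ?N - h)"
  proof (rule sum_strict_mono)
    fix \<omega> assume \<omega>: "\<omega> \<in> \<Omega>"
    have "ln (c \<omega>) < ln (?N * exp (- h))"
      using small[OF \<omega>] cpos[OF \<omega>] N by (subst ln_less_cancel_iff) auto
    then show "ln (c \<omega>) < ln ?N - h" using N by (simp add: ln_mult)
  qed fact+
  moreover have "(\<Sum>\<omega>\<in>\<Omega>. ln (Q (V \<omega>))) \<ge> - (?N * h)"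
  proof -
    have "(\<Sum>\<omega>\<in>\<Omega>. ln (Q (V \<omega>))) = - (\<Sum>i\<in>I. \<Sum>\<omega>\<in>\<Omega>. - ln (q i (v i \<omega>)))"
      unfolding lnQ by (subst sum.swap) (simp add: sum_negf)
    then show ?thesis using cost by simp
  qed
  ultimately show False
    using A by (simp add: sum_subtractf sum.distrib algebra_simps)
qed

section \<open>Hamming balls and the partial colouring lemma\<close>

lemma sum_Pow_power_card:
  fixes r :: real
  assumes "finite X"
  shows "(\<Sum>A\<in>Pow X. r ^ card A) = (1 + r) ^ card X"
  using prod_add[OF assms, of "\<lambda>_. r" "\<lambda>_. 1"] by (simp add: add.commute)

text \<open>Markov's inequality for an exponential weight: as 16^(m/16) = 2^(m/4) for m =
  \<open>card X\<close>, the weight 2^(m/4) * (1/16)^distance is at least 1 on the ball, and its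
  total over the cube factorises.\<close>

lemma card_hamming_ball_le:
  assumes X: "finite X" and A: "A \<subseteq> X"
  shows "real (card {B\<in>Pow X. 16 * card (sym_diff A B) < card X}) \<le> (17/16 * 2 powr (1/4)) ^ card X"
proof -
  let ?S = "{B\<in>Pow X. 16 * card (sym_diff A B) < card X}"
  let ?m = "card X"
  \<comment> \<open>\<open>sym_diff A\<close> is an involution of the cube that moves the centre of
    the ball to the empty set.\<close>
  have bij: "bij_betw (sym_diff A) (Pow X) (Pow X)"
    using A by (intro bij_betwI[where g = "sym_diff A"]) auto
  have "real (card ?S) = (\<Sum>B\<in>?S. 1)" by simp
  also have "\<dots> \<le> (\<Sum>B\<in>?S. 2 powr (?m / 4) * (1/16) ^ card (sym_diff A B))"
  proof (rule sum_mono)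
    fix B assume B: "B \<in> ?S"
    have "(1/16 :: real) ^ card (sym_diff A B) = 2 powr (- (4 * card (sym_diff A B)))"
    proof -
      have "2 powr (4 * card (sym_diff A B)) = (2 ^ (4 * card (sym_diff A B)) :: real)"
        by (subst powr_realpow[symmetric]) auto
      then show ?thesis
        by (simp add: powr_minus power_divide power_mult inverse_eq_divide)
    qed
    then have "2 powr (?m / 4) * (1/16 :: real) ^ card (sym_diff A B) = 2 powr (?m / 4 - 4 * card (sym_diff A B))"
      by (simp add: powr_add[symmetric])
    moreover have "?m / 4 - 4 * real (card (sym_diff A B)) \<ge> 0" using B by simp
    ultimately show "1 \<le> 2 powr (?m / 4) * (1/16 :: real) ^ card (sym_diff A B)"
      by (simp add: ge_one_powr_ge_zero)
  qed
  also have "\<dots> \<le> (\<Sum>B\<in>Pow X. 2 powr (?m / 4) * (1/16) ^ card (sym_diff A B))"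
    using X by (intro sum_mono2) auto
  also have "\<dots> = 2 powr (?m / 4) * (\<Sum>B\<in>Pow X. (1/16) ^ card (sym_diff A B))"
    by (simp add: sum_distrib_left)
  also have "(\<Sum>B\<in>Pow X. (1/16 :: real) ^ card (sym_diff A B)) = (\<Sum>B\<in>Pow X. (1/16) ^ card B)"
    by (rule sum.reindex_bij_betw[OF bij])
  also have "\<dots> = (17/16) ^ ?m"
    unfolding sum_Pow_power_card[OF X] by simp
  also have "2 powr (?m / 4) = (2 powr (1/4)) ^ ?m"
    by (simp add: powr_power)
  finally show ?thesis by (simp only: power_mult_distrib mult.commute)
qed

text \<open>This makes a fibre of relative size exp(-m/4) larger than a ball of radius m/16. Fourth
  powers remove the roots: 2 * (17/16)^4 is about 2.55, while 16 / e exceeds 5.\<close>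

lemma hamming_ball_less_fibre: "17/16 * 2 powr (1/4) < 2 * exp (- 1/4 :: real)"
proof (rule power_less_imp_less_base)
  have "exp 1 \<le> (3::real)" by (rule exp_le)
  have a: "(17/16 * 2 powr (1/4)) ^ 4 = (17/16) ^ 4 * (2::real)"
    by (simp only: power_mult_distrib) (simp add: powr_power)
  have b: "(2 * exp (- 1/4 :: real)) ^ 4 = 16 / exp 1"
  proof -
    have "exp (- 1/4 :: real) ^ 4 = exp (4 * (- 1/4))"
      using exp_of_nat_mult[of 4 "- 1/4 :: real"] by (simp only: of_nat_numeral)
    also have "\<dots> = inverse (exp 1)" by (simp add: exp_minus)
    finally have e: "exp (- 1/4 :: real) ^ 4 = inverse (exp 1)" .
    show ?thesis
      unfolding power_mult_distrib e by (simp add: divide_inverse)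
  qed
  show "(17/16 * 2 powr (1/4)) ^ 4 < (2 * exp (- 1/4 :: real)) ^ 4"
    unfolding a b using \<open>exp 1 \<le> (3::real)\<close> by (simp add: field_simps power_divide)
qed auto

text \<open>A fibre of colourings with equal rounded sums does not fit into a Hamming ball, so it
  contains two colourings that differ on at least a sixteenth of \<open>X\<close>.\<close>

lemma partial_colouring:
  fixes q :: "'i \<Rightarrow> int \<Rightarrow> real" and \<Delta> :: "'i \<Rightarrow> real" and S :: "'i \<Rightarrow> 'a set"
  assumes X: "finite X" "X \<noteq> {}" and I: "finite I"
    and S: "\<And>i. i \<in> I \<Longrightarrow> S i \<subseteq> X"
    and \<Delta>: "\<And>i. i \<in> I \<Longrightarrow> \<Delta> i > 0"
    and q_pos: "\<And>i k. i \<in> I \<Longrightarrow> q i k > 0"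
    and q_sum: "\<And>i F. i \<in> I \<Longrightarrow> finite F \<Longrightarrow> (\<Sum>k\<in>F. q i k) \<le> 1"
    and cost: "(\<Sum>i\<in>I. \<Sum>A\<in>Pow X. - ln (q i (round (signed_sum A (S i) / \<Delta> i)))) \<le> 2 ^ card X * (card X / 4)"
  obtains c :: "'a \<Rightarrow> int" where "\<And>x. x \<in> X \<Longrightarrow> c x \<in> {-1, 0, 1}"
    "16 * card {x\<in>X. c x = 0} \<le> 15 * card X"
    "\<And>i. i \<in> I \<Longrightarrow> \<bar>real_of_int (\<Sum>x\<in>S i. c x)\<bar> \<le> \<Delta> i"
proof -
  define v where "v = (\<lambda>i A. round (signed_sum A (S i) / \<Delta> i))"
  have "\<exists>A\<in>Pow X. card (Pow X) * exp (- (card X / 4)) \<le> card {B\<in>Pow X. \<forall>i\<in>I. v i B = v i A}"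
    by (rule ex_large_fibre[where q = q]) (use assms in \<open>auto simp: v_def card_Pow\<close>)
  then obtain A where A: "A \<subseteq> X"
    and "card (Pow X) * exp (- (card X / 4)) \<le> card {B\<in>Pow X. \<forall>i\<in>I. v i B = v i A}"
    by auto
  moreover have "card (Pow X) * exp (- (card X / 4)) = (2 * exp (- 1/4)) ^ card X"
    using X by (simp add: card_Pow power_mult_distrib exp_of_nat_mult[symmetric])
  moreover have "(17/16 * 2 powr (1/4)) ^ card X < (2 * exp (- 1/4 :: real)) ^ card X"
    using X by (intro power_strict_mono hamming_ball_less_fibre) (auto simp: card_gt_0_iff)
  ultimately have "card {B\<in>Pow X. 16 * card (sym_diff A B) < card X} < card {B\<in>Pow X. \<forall>i\<in>I. v i B = v i A}"
    using card_hamming_ball_le[OF X(1) A] by linarith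
  moreover have "finite {B\<in>Pow X. 16 * card (sym_diff A B) < card X}"
    using X(1) by simp
  ultimately have "\<not> {B\<in>Pow X. \<forall>i\<in>I. v i B = v i A} \<subseteq> {B\<in>Pow X. 16 * card (sym_diff A B) < card X}"
    by (meson card_mono linorder_not_less)
  then obtain B where "B \<in> Pow X" "\<forall>i\<in>I. v i B = v i A" "\<not> 16 * card (sym_diff A B) < card X"
    by blast
  then have B: "B \<subseteq> X" "\<And>i. i \<in> I \<Longrightarrow> v i B = v i A" "card X \<le> 16 * card (sym_diff A B)"
    by simp_all
  \<comment> \<open>Half the difference of the two sign patterns: zero exactly where they
    agree.\<close>
  define c :: "'a \<Rightarrow> int" where "c = (\<lambda>x. (if x \<in> A then 1 else 0) - (if x \<in> B then 1 else 0))"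
  show thesis
  proof
    show "c x \<in> {-1, 0, 1}" for x by (simp add: c_def)
    have "{x\<in>X. c x = 0} = X - sym_diff A B" by (auto simp: c_def split: if_splits)
    moreover have "card (X - sym_diff A B) = card X - card (sym_diff A B)"
      using A B X by (intro card_Diff_subset) (auto intro: finite_subset)
    ultimately show "16 * card {x\<in>X. c x = 0} \<le> 15 * card X"
      using B(3) by simp
  next
    fix i assume i: "i \<in> I"
    let ?a = "signed_sum A (S i) / \<Delta> i" and ?b = "signed_sum B (S i) / \<Delta> i"
    have "round ?a = round ?b" using B(2)[OF i] by (simp add: v_def)
    \<comment> \<open>Reals with the same rounding differ by at most 1. Halving even gives
      \<open>\<Delta> i / 2\<close>, of which only \<open>\<Delta> i\<close> is kept.\<close>
    then have "\<bar>?a - ?b\<bar> \<le> 1"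
      using of_int_round_abs_le[of ?a] of_int_round_abs_le[of ?b] by linarith
    then have "\<bar>signed_sum A (S i) - signed_sum B (S i)\<bar> \<le> \<Delta> i"
      using \<Delta>[OF i] by (simp add: diff_divide_distrib[symmetric] abs_divide)
    moreover have "signed_sum A (S i) - signed_sum B (S i) = 2 * real_of_int (\<Sum>x\<in>S i. c x)"
      unfolding signed_sum_def of_int_sum sum_subtractf[symmetric] sum_distrib_left c_def
      by (intro sum.cong) auto
    ultimately show "\<bar>real_of_int (\<Sum>x\<in>S i. c x)\<bar> \<le> \<Delta> i" by linarith
  qed
qed

section \<open>Mass and expected code length of the weights\<close>

lemma sum_exp_nat_le:
  fixes l :: real
  assumes l: "l > 0" and F: "finite F" "(0::nat) \<notin> F"
  shows "(\<Sum>k\<in>F. exp (- l * k)) \<le> 1 / l"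
proof -
  define r where "r = exp (- l)"
  have r: "0 < r" "r < 1" using l by (auto simp: r_def)
  have "(\<Sum>k\<in>insert 0 F. r ^ k) \<le> (\<Sum>k. r ^ k)"
    using r F by (intro sum_le_suminf summable_geometric) auto
  also have "\<dots> = 1 / (1 - r)" using r by (intro suminf_geometric) auto
  finally have "(\<Sum>k\<in>F. r ^ k) \<le> 1 / (1 - r) - 1" using F by simp
  also have "\<dots> = r / (1 - r)" using r by (simp add: field_simps)
  also have "\<dots> = 1 / (exp l - 1)" using l by (simp add: r_def exp_minus field_simps)
  also have "\<dots> \<le> 1 / l"
  proof (rule divide_left_mono)
    show "l \<le> exp l - 1" using exp_ge_add_one_self[of l] by linarith
  qed (use l in auto)
  finally show ?thesis by (simp add: r_def exp_of_nat_mult[symmetric] mult_ac)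
qed

lemma sum_exp_abs_int_le:
  fixes l :: real
  assumes l: "l > 0" and F: "finite F" "(0::int) \<notin> F"
  shows "(\<Sum>k\<in>F. exp (- l * \<bar>k\<bar>)) \<le> 2 / l"
proof -
  let ?P = "{k\<in>F. k > 0}" and ?N = "{k\<in>F. k < 0}"
  have "F = ?P \<union> ?N" using F by (auto simp: not_less le_less)
  then have "(\<Sum>k\<in>F. exp (- l * \<bar>k\<bar>)) = (\<Sum>k\<in>?P. exp (- l * \<bar>k\<bar>)) + (\<Sum>k\<in>?N. exp (- l * \<bar>k\<bar>))"
    using F by (metis (no_types, lifting) sum.union_disjoint disjoint_iff finite_Un less_asym mem_Collect_eq)
  also have "(\<Sum>k\<in>?P. exp (- l * \<bar>k\<bar>)) = (\<Sum>k\<in>nat ` ?P. exp (- l * k))"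
    by (subst sum.reindex) (auto simp: inj_on_def intro!: sum.cong)
  also have "(\<Sum>k\<in>?N. exp (- l * \<bar>k\<bar>)) = (\<Sum>k\<in>(\<lambda>k. nat (- k)) ` ?N. exp (- l * k))"
    by (subst sum.reindex) (auto simp: inj_on_def intro!: sum.cong)
  finally show ?thesis
    using sum_exp_nat_le[OF l, of "nat ` ?P"] sum_exp_nat_le[OF l, of "(\<lambda>k. nat (- k)) ` ?N"] F
    by (auto simp: image_iff)
qed

text \<open>The two weight functions are chosen so that the expected code length of the rounded value
  is logarithmic when the rounding step is small compared to the standard deviation, and decays
  quickly when the rounding step is large.\<close>

definition fine_weight :: "real \<Rightarrow> int \<Rightarrow> real" where
  "fine_weight l k = l / 3 * exp (- l * \<bar>k\<bar>)"

definition coarse_weight :: "real \<Rightarrow> int \<Rightarrow> real" where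
  "coarse_weight u k = (if k = 0 then exp (- 3 * exp (- u\<^sup>2)) else exp (- u\<^sup>2) * exp (- 1 * \<bar>k\<bar>))"

lemma fine_weight_pos: "l > 0 \<Longrightarrow> fine_weight l k > 0"
  by (simp add: fine_weight_def)

lemma coarse_weight_pos: "coarse_weight u k > 0"
  by (simp add: coarse_weight_def)

text \<open>The exponentials sum to at most \<open>1 + 2 / l\<close>, so the factor
  \<open>l / 3\<close> brings the mass to \<open>(l + 2) / 3\<close>.\<close>

lemma sum_fine_weight_le:
  assumes l: "0 < l" "l \<le> 1" and F: "finite F"
  shows "(\<Sum>k\<in>F. fine_weight l k) \<le> 1"
proof -
  have "(\<Sum>k\<in>F. fine_weight l k) \<le> (\<Sum>k\<in>insert 0 F. fine_weight l k)"
    using F l by (intro sum_mono2) (auto simp: less_imp_le[OF fine_weight_pos])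
  also have "\<dots> = l / 3 * (1 + (\<Sum>k\<in>F - {0}. exp (- l * \<bar>k\<bar>)))"
    using F by (simp add: sum.insert_remove fine_weight_def sum_distrib_left distrib_left)
  also have "\<dots> \<le> l / 3 * (1 + 2 / l)"
    using sum_exp_abs_int_le[of l "F - {0}"] F l by (intro mult_left_mono) auto
  also have "\<dots> \<le> 1" using l by (simp add: field_simps)
  finally show ?thesis .
qed

text \<open>With \<open>d = exp (- u\<^sup>2)\<close> the nonzero integers weigh at most
  \<open>2 * d\<close>. The 3 in the exponent at 0 makes room for them:
  \<open>exp (- 3 * d) \<le> 1 - 2 * d\<close> once \<open>d \<le> 1/6\<close>.\<close>

lemma sum_coarse_weight_le:
  assumes u: "u \<ge> 4" and F: "finite F"
  shows "(\<Sum>k\<in>F. coarse_weight u k) \<le> 1"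
proof -
  define d where "d = exp (- u\<^sup>2)"
  have "u\<^sup>2 \<ge> 4\<^sup>2" using u by (intro power_mono) auto
  then have "6 \<le> exp (u\<^sup>2)" using exp_ge_add_one_self[of "u\<^sup>2"] by (simp del: exp_ge_add_one_self)
  then have d: "0 < d" "d \<le> 1/6" by (auto simp: d_def exp_minus field_simps)
  have "(\<Sum>k\<in>F. coarse_weight u k) \<le> (\<Sum>k\<in>insert 0 F. coarse_weight u k)"
    using F by (intro sum_mono2) (auto simp: less_imp_le[OF coarse_weight_pos])
  also have "\<dots> = exp (- 3 * d) + d * (\<Sum>k\<in>F - {0}. exp (- 1 * \<bar>k\<bar>))"
    using F by (simp add: sum.insert_remove coarse_weight_def sum_distrib_left d_def)
  also have "\<dots> \<le> exp (- 3 * d) + d * (2 / 1)"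
    using sum_exp_abs_int_le[of 1 "F - {0}"] F d by (intro add_left_mono mult_left_mono) auto
  also have "exp (- 3 * d) \<le> 1 / (1 + 3 * d)"
    using exp_ge_add_one_self[of "3 * d"] d by (simp add: exp_minus field_simps)
  also have "1 / (1 + 3 * d) \<le> 1 - 2 * d"
  proof -
    have "0 \<le> d * (1 - 6 * d)" using d by (intro mult_nonneg_nonneg) auto
    then have "1 \<le> (1 - 2 * d) * (1 + 3 * d)" by (simp add: algebra_simps)
    then show ?thesis using d by (simp add: pos_divide_le_eq)
  qed
  finally show ?thesis by simp
qed

lemma abs_round_le: "\<bar>real_of_int (round x)\<bar> \<le> \<bar>x\<bar> + 1/2"
  using of_int_round_abs_le[of x] by linarith

lemma exp_abs_le_cosh: "exp \<bar>x\<bar> \<le> 2 * cosh (x::real)"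
  by (cases "x \<ge> 0") (auto simp: cosh_def)

text \<open>The integer k has code length ln (3 / l) + l |k|. The factor \<open>l\<close> undoes the
  fineness of the rounding: l |k| is about the sum measured in standard deviations
  \<open>sqrt (card S)\<close>, whose mean is bounded independently of \<open>l\<close>.\<close>

lemma sum_fine_cost_le:
  assumes X: "finite X" "S \<subseteq> X" "S \<noteq> {}" and l: "0 < l" "l \<le> 1"
  shows "(\<Sum>A\<in>Pow X. - ln (fine_weight l (round (signed_sum A S / (l * sqrt (card S))))))
    \<le> 2 ^ card X * (ln (1 / l) + 6)"
proof -
  define s where "s = sqrt (card S)"
  have "card S > 0" using X by (auto simp: card_gt_0_iff intro: finite_subset)
  then have s: "s > 0" "s\<^sup>2 = card S" by (auto simp: s_def)
  have pt: "- ln (fine_weight l (round (signed_sum A S / (l * s))))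
     \<le> ln (1 / l) + 2 + (2 * cosh (1 / s * signed_sum A S) - 1/2)" for A
  proof -
    let ?y = "1 / s * signed_sum A S"
    have "- ln (fine_weight l (round (signed_sum A S / (l * s))))
        = ln 3 + ln (1 / l) + l * \<bar>real_of_int (round (signed_sum A S / (l * s)))\<bar>"
      using l by (simp add: fine_weight_def ln_mult ln_div)
    also have "\<dots> \<le> ln 3 + ln (1 / l) + l * (\<bar>signed_sum A S / (l * s)\<bar> + 1/2)"
      using l by (intro add_left_mono mult_left_mono abs_round_le) simp
    also have "l * (\<bar>signed_sum A S / (l * s)\<bar> + 1/2) = \<bar>?y\<bar> + l / 2"
      using l s by (simp add: abs_mult abs_divide field_simps)
    also have "\<bar>?y\<bar> \<le> 2 * cosh ?y - 1"
      using exp_ge_add_one_self[of "\<bar>?y\<bar>"] exp_abs_le_cosh[of ?y] by linarith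
    also have "ln 3 \<le> (2::real)" using ln_le_minus_one[of "3::real"] by simp
    finally show ?thesis using l by simp
  qed
  have "(\<Sum>A\<in>Pow X. - ln (fine_weight l (round (signed_sum A S / (l * s)))))
     \<le> (\<Sum>A\<in>Pow X. ln (1 / l) + 2 + (2 * cosh (1 / s * signed_sum A S) - 1/2))"
    by (intro sum_mono pt)
  also have "\<dots> = 2 ^ card X * (ln (1 / l) + 3/2) + 2 * (\<Sum>A\<in>Pow X. cosh (1 / s * signed_sum A S))"
    using X by (simp add: sum.distrib sum_subtractf sum_distrib_left card_Pow algebra_simps)
  also have "\<dots> \<le> 2 ^ card X * (ln (1 / l) + 3/2) + 2 * (2 ^ card X * exp ((1 / s)\<^sup>2 * card S / 2))"
    using sum_Pow_cosh_signed_sum_le[OF X(1,2), of "1 / s"] by simp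
  also have "(1 / s)\<^sup>2 * card S / 2 = 1 / 2"
    using s \<open>card S > 0\<close> by (simp add: power_divide)
  also have "exp (1 / 2 :: real) \<le> 2"
    using exp_half_le2 by simp
  finally have "(\<Sum>A\<in>Pow X. - ln (fine_weight l (round (signed_sum A S / (l * s)))))
    \<le> 2 ^ card X * (ln (1 / l) + 3/2) + 2 * (2 ^ card X * 2)" by simp
  also have "\<dots> = 2 ^ card X * (ln (1 / l) + 11/2)" by (simp add: algebra_simps)
  also have "\<dots> \<le> 2 ^ card X * (ln (1 / l) + 6)" by simp
  finally show ?thesis by (simp add: s_def)
qed

text \<open>The rounded value is nonzero only if the sum reaches \<open>u\<close> standard
  deviations, an event of probability at most \<open>2 * exp (- u\<^sup>2 / 2)\<close>; the longer
  code adds a factor of order \<open>u\<^sup>2\<close>. The power 12 is chosen because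
  \<open>u = 8 * 2 powr (j / 4)\<close> turns it into \<open>8 ^ j\<close>.\<close>

lemma sum_coarse_cost_le:
  assumes X: "finite X" "S \<subseteq> X" "S \<noteq> {}" and u: "u \<ge> 4"
  shows "(\<Sum>A\<in>Pow X. - ln (coarse_weight u (round (signed_sum A S / (2 * u * sqrt (card S))))))
    \<le> 2 ^ card X * (2 ^ 30 / u ^ 12)"
proof -
  define s where "s = sqrt (card S)"
  have "card S > 0" using X by (auto simp: card_gt_0_iff intro: finite_subset)
  then have s: "s > 0" "s\<^sup>2 = card S" by (auto simp: s_def)
  define d where "d = exp (- u\<^sup>2)"
  have u2: "u\<^sup>2 \<ge> 16" using power_mono[of 4 u 2] u by simp
  \<comment> \<open>Chernoff's method, pointwise: the exponent \<open>u / s\<close> is tuned to the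
    threshold, and the mean of this \<open>cosh\<close> is at most
    \<open>exp (u\<^sup>2 / 2)\<close>.\<close>
  have pt: "- ln (coarse_weight u (round (signed_sum A S / (2 * u * s))))
     \<le> 3 * d + 4 * u\<^sup>2 * d * cosh (u / s * signed_sum A S)" for A
  proof (cases "round (signed_sum A S / (2 * u * s)) = 0")
    case True
    have "0 \<le> 4 * u\<^sup>2 * d * cosh (u / s * signed_sum A S)"
      by (intro mult_nonneg_nonneg) (auto simp: d_def)
    then show ?thesis using True by (simp add: coarse_weight_def d_def)
  next
    case False
    define y where "y = \<bar>signed_sum A S / s\<bar>"
    let ?k = "round (signed_sum A S / (2 * u * s))"
    have z: "\<bar>signed_sum A S / (2 * u * s)\<bar> = y / (2 * u)"
      using u s by (simp add: y_def abs_divide abs_mult field_simps)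
    have k1: "1 \<le> \<bar>real_of_int ?k\<bar>" using False by linarith
    have k2: "\<bar>real_of_int ?k\<bar> \<le> y / (2 * u) + 1/2" using abs_round_le[of "signed_sum A S / (2 * u * s)"] z by simp
    have "1/2 \<le> y / (2 * u)" using k1 k2 by linarith
    then have yu: "y \<ge> u" using u by (simp add: field_simps)
    have "y / (2 * u) \<le> y / 8" using yu u by (intro divide_left_mono) auto
    moreover have "4 * y \<le> y * y" using yu u by (intro mult_right_mono) auto
    moreover have "u\<^sup>2 \<le> y\<^sup>2" using yu u by (intro power_mono) auto
    moreover have "y * y = y\<^sup>2" by (simp add: power2_eq_square)
    ultimately have "u\<^sup>2 + \<bar>real_of_int ?k\<bar> \<le> 2 * y\<^sup>2"
      using k2 u yu by linarith
    \<comment> \<open>By 1 + x <= exp x, the ratio \<open>y\<^sup>2 / u\<^sup>2\<close> grows at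
      most like \<open>exp (2 * ((y - u) / u))\<close>, which the exponential moment absorbs because
      \<open>2 / u \<le> u\<close>.\<close>
    also have "y\<^sup>2 = u\<^sup>2 * (1 + (y - u) / u)\<^sup>2" using u by (simp add: field_simps)
    also have "(1 + (y - u) / u)\<^sup>2 \<le> (exp ((y - u) / u))\<^sup>2"
      using u yu exp_ge_add_one_self[of "(y - u) / u"] by (intro power_mono) auto
    also have "(exp ((y - u) / u))\<^sup>2 = exp (2 * ((y - u) / u))"
      by (rule exp_double[symmetric])
    also have "\<dots> \<le> exp (u * (y - u))"
    proof -
      have "2 * ((y - u) / u) = (y - u) * (2 / u)" by simp
      also have "\<dots> \<le> (y - u) * u"
        using u2 u yu by (intro mult_left_mono) (auto simp: field_simps power2_eq_square)
      finally show ?thesis by (simp add: mult.commute)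
    qed
    also have "exp (u * (y - u)) = d * exp (u * y)"
      by (simp add: d_def exp_add[symmetric] algebra_simps power2_eq_square)
    also have "u * y = \<bar>u / s * signed_sum A S\<bar>"
      using u s by (simp add: y_def abs_mult abs_divide)
    also have "exp \<dots> \<le> 2 * cosh (u / s * signed_sum A S)" by (rule exp_abs_le_cosh)
    finally have "u\<^sup>2 + \<bar>real_of_int ?k\<bar> \<le> 2 * (u\<^sup>2 * (d * (2 * cosh (u / s * signed_sum A S))))"
      by (simp add: d_def mult_left_mono)
    moreover have "- ln (coarse_weight u ?k) = u\<^sup>2 + \<bar>real_of_int ?k\<bar>"
      using False by (simp add: coarse_weight_def ln_mult)
    moreover have "d > 0" by (simp add: d_def)
    ultimately show ?thesis by (simp add: mult_ac)
  qed
  have "(\<Sum>A\<in>Pow X. - ln (coarse_weight u (round (signed_sum A S / (2 * u * s)))))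
     \<le> (\<Sum>A\<in>Pow X. 3 * d + 4 * u\<^sup>2 * d * cosh (u / s * signed_sum A S))"
    by (intro sum_mono pt)
  also have "\<dots> = 2 ^ card X * (3 * d) + 4 * u\<^sup>2 * d * (\<Sum>A\<in>Pow X. cosh (u / s * signed_sum A S))"
    using X by (simp add: sum.distrib sum_distrib_left card_Pow)
  also have "\<dots> \<le> 2 ^ card X * (3 * d) + 4 * u\<^sup>2 * d * (2 ^ card X * exp ((u / s)\<^sup>2 * card S / 2))"
    using sum_Pow_cosh_signed_sum_le[OF X(1,2), of "u / s"]
    by (intro add_left_mono mult_left_mono) (auto simp: d_def)
  also have "(u / s)\<^sup>2 * card S / 2 = u\<^sup>2 / 2"
    using s \<open>card S > 0\<close> by (simp add: power_divide)
  also have "2 ^ card X * (3 * d) + 4 * u\<^sup>2 * d * (2 ^ card X * exp (u\<^sup>2 / 2))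
      = 2 ^ card X * (3 * d + 4 * u\<^sup>2 * (d * exp (u\<^sup>2 / 2)))"
    by (simp add: algebra_simps)
  also have "\<dots> \<le> 2 ^ card X * (2 ^ 30 / u ^ 12)"
  proof (rule mult_left_mono)
    define E where "E = exp (- (u\<^sup>2 / 2))"
    have E: "d * exp (u\<^sup>2 / 2) = E"
      by (simp add: d_def E_def exp_add[symmetric])
    have "d \<le> E" by (simp add: d_def E_def)
    moreover have "E \<le> u\<^sup>2 * E" using u2 by (simp add: E_def)
    ultimately have "3 * d + 4 * u\<^sup>2 * (d * exp (u\<^sup>2 / 2)) \<le> 7 * (u\<^sup>2 * E)"
      unfolding E by linarith
    also have "\<dots> = 7 * u\<^sup>2 / exp (u\<^sup>2 / 2)" by (simp add: E_def exp_minus field_simps)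
    \<comment> \<open>The seventh power supplies \<open>u ^ 14\<close>, of which the prefactor
      consumes two powers; \<open>7 * 14 ^ 7\<close> is below \<open>2 ^ 30\<close>.\<close>
    also have "\<dots> \<le> 7 * u\<^sup>2 / (u\<^sup>2 / 14) ^ 7"
    proof (rule divide_left_mono)
      have "(u\<^sup>2 / 14) ^ 7 \<le> (1 + (u\<^sup>2 / 2) / real 7) ^ 7" using u2 by (intro power_mono) auto
      also have "\<dots> \<le> exp (u\<^sup>2 / 2)"
        using u2 by (intro exp_ge_one_plus_x_over_n_power_n) auto
      finally show "(u\<^sup>2 / 14) ^ 7 \<le> exp (u\<^sup>2 / 2)" .
    qed (use u2 in \<open>auto intro!: mult_pos_pos\<close>)
    also have "\<dots> = 7 * 14 ^ 7 / u ^ 12"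
      using u by (simp add: power_divide power_mult[symmetric] field_simps flip: power_add)
    also have "\<dots> \<le> 2 ^ 30 / u ^ 12"
      using u by (intro divide_right_mono) auto
    finally show "3 * d + 4 * u\<^sup>2 * (d * exp (u\<^sup>2 / 2)) \<le> 2 ^ 30 / u ^ 12" .
  qed simp
  finally show ?thesis by (simp add: s_def)
qed

section \<open>Steps with long orbits\<close>

text \<open>By 1 + x <= exp x the product is at most the exponential of a sum over primes, and the
  same sum over all k >= 2 telescopes to at most 1.\<close>

lemma prod_one_plus_pronic_inverse_le:
  "(\<Prod>p | prime p \<and> p \<le> (G::nat). 1 + 1 / (real p * (real p - 1))) \<le> exp 1"
proof -
  have tele: "(\<Sum>k=2..G. 1 / (real k * (real k - 1))) \<le> 1" 
  proof -
    have "(\<Sum>k=2..G. 1 / (real k * (real k - 1))) = (if G \<ge> 1 then 1 - 1 / real G else 0)"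
    proof (induction G)
      case (Suc G)
      show ?case
      proof (cases "G \<ge> 1")
        case True
        then have "1 - 1 / real G + 1 / (real (Suc G) * real G) = 1 - 1 / real (Suc G)"
          using True by (simp add: divide_simps) (simp add: algebra_simps)
        then show ?thesis using Suc True by (simp add: algebra_simps)
      qed simp
    qed simp
    then show ?thesis by simp
  qed
  have "(\<Prod>p | prime p \<and> p \<le> G. 1 + 1 / (real p * (real p - 1)))
     \<le> (\<Prod>p | prime p \<and> p \<le> G. exp (1 / (real p * (real p - 1))))"
    by (intro prod_mono) (auto dest: prime_ge_2_nat intro!: exp_ge_add_one_self)
  also have "\<dots> = exp (\<Sum>p | prime p \<and> p \<le> G. 1 / (real p * (real p - 1)))"
    by (simp add: exp_sum)
  also have "(\<Sum>p | prime p \<and> p \<le> G. 1 / (real p * (real p - 1))) \<le> (\<Sum>k=2..G. 1 / (real k * (real k - 1)))"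
    by (intro sum_mono2) (auto dest: prime_ge_2_nat)
  finally show ?thesis using tele by (meson exp_le_cancel_iff order_trans)
qed

text \<open>\<open>g / totient g\<close> is the product of \<open>1 + 1 / (p - 1)\<close> over the
  primes dividing \<open>g\<close>. Expanded over sets of primes, it allows an exchange of summation
  when \<open>g\<close> varies.\<close>

lemma inverse_totient_eq:
  assumes "g > 0"
  shows "1 / real (totient g) = 1 / real g * (\<Sum>T\<in>Pow (prime_factors g). \<Prod>p\<in>T. 1 / (real p - 1))"
proof -
  have "real (totient g) = real g * (\<Prod>p\<in>prime_factors g. 1 - 1 / real p)"
    by (rule totient_formula2)
  then have "1 / real (totient g) = 1 / real g * (\<Prod>p\<in>prime_factors g. inverse (1 - 1 / real p))"
    by (simp add: prod_inversef[unfolded comp_def] divide_inverse)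
  also have "(\<Prod>p\<in>prime_factors g. inverse (1 - 1 / real p)) = (\<Prod>p\<in>prime_factors g. 1 / (real p - 1) + 1)"
  proof (rule prod.cong[OF refl])
    fix p assume "p \<in> prime_factors g"
    then have "real p \<ge> 2" using prime_ge_2_nat[of p] by auto
    then show "inverse (1 - 1 / real p) = 1 / (real p - 1) + 1" by (simp add: field_simps)
  qed
  also have "\<dots> = (\<Sum>T\<in>Pow (prime_factors g). \<Prod>p\<in>T. 1 / (real p - 1))"
    by (simp add: prod_add)
  finally show ?thesis .
qed

lemma sum_inverse_le_one_plus_ln:
  assumes "n > 0"
  shows "(\<Sum>k=1..n. 1 / real k) \<le> 1 + ln (real n)"
  using assms
proof (induction n rule: nat_induct_non_zero)
  case (Suc n)
  have "ln (real n / real (Suc n)) \<le> real n / real (Suc n) - 1"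
    using Suc by (intro ln_le_minus_one) auto
  then have "1 / real (Suc n) \<le> ln (real (Suc n)) - ln (real n)"
    using Suc by (simp add: ln_div field_simps)
  then show ?case using Suc.IH by simp
qed simp

lemma prod_primes_dvd:
  fixes g :: nat
  assumes "finite T" "\<And>p. p \<in> T \<Longrightarrow> prime p" "\<And>p. p \<in> T \<Longrightarrow> p dvd g"
  shows "\<Prod>T dvd g"
  using assms
proof (induction T rule: finite_induct)
  case (insert p T)
  have "coprime p (\<Prod>T)"
    using insert by (intro prod_coprime_right) (auto intro: primes_coprime)
  then show ?case using insert by (simp add: divides_mult)
qed simp

text \<open>After the exchange, \<open>g\<close> runs over multiples of the product D of a set
  \<open>T\<close> of primes, which costs 1/D times a harmonic sum. Each prime then contributes only
  \<open>1 / (p * (p - 1))\<close>, so the resulting Euler product stays bounded.\<close>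

lemma sum_inverse_totient_le:
  assumes G: "G > 0"
  shows "(\<Sum>g=1..G. 1 / real (totient g)) \<le> exp 1 * (1 + ln (real G))"
proof -
  define P where "P = {p. prime p \<and> p \<le> G}"
  have finP: "finite P" by (simp add: P_def)
  define w where "w = (\<lambda>T. \<Prod>p\<in>T. 1 / (real p - 1))"
  have w_nonneg: "w T \<ge> 0" if "T \<subseteq> P" for T
    unfolding w_def
  proof (rule prod_nonneg)
    fix p assume "p \<in> T"
    then have "p \<ge> 2" using that prime_ge_2_nat[of p] by (auto simp: P_def)
    then show "0 \<le> 1 / (real p - 1)" by simp
  qed
  have sub: "prime_factors g \<subseteq> P" if "g \<in> {1..G}" for g
    using that by (auto simp: P_def dest!: dvd_imp_le)
  have inner: "(\<Sum>g\<in>{g\<in>{1..G}. T \<subseteq> prime_factors g}. 1 / real g) \<le> (\<Prod>p\<in>T. 1 / real p) * (\<Sum>k=1..G. 1 / real k)"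
    if T: "T \<subseteq> P" for T
  proof -
    define D where "D = \<Prod>T"
    have finT: "finite T" using T finP finite_subset by blast
    have Dpos: "D > 0" unfolding D_def using T by (intro prod_pos) (auto simp: P_def prime_gt_0_nat)
    have "g \<in> (\<lambda>k. D * k) ` {1..G}" if g: "g \<in> {1..G}" "T \<subseteq> prime_factors g" for g
    proof -
      have "D dvd g"
        unfolding D_def
        using g T finT by (intro prod_primes_dvd) (auto simp: P_def)
      then obtain k where k: "g = D * k" by blast
      have "k \<noteq> 0" using g k by (intro notI) simp
      moreover have "k \<le> g" using k Dpos by simp
      ultimately have "k \<in> {1..G}" using g by simp
      then show ?thesis using k by blast
    qed
    then have "(\<Sum>g\<in>{g\<in>{1..G}. T \<subseteq> prime_factors g}. 1 / real g) \<le> (\<Sum>g\<in>(\<lambda>k. D * k) ` {1..G}. 1 / real g)"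
      by (intro sum_mono2) auto
    also have "\<dots> = (\<Sum>k=1..G. 1 / real D * (1 / real k))"
      using Dpos by (subst sum.reindex) (auto simp: inj_on_def)
    also have "\<dots> = 1 / real D * (\<Sum>k=1..G. 1 / real k)"
      by (simp add: sum_distrib_left)
    also have "1 / real D = (\<Prod>p\<in>T. 1 / real p)"
      by (simp add: D_def prod_dividef)
    finally show ?thesis .
  qed
  have "(\<Sum>g=1..G. 1 / real (totient g)) = (\<Sum>g=1..G. \<Sum>T\<in>{T\<in>Pow P. T \<subseteq> prime_factors g}. 1 / real g * w T)"
  proof (rule sum.cong[OF refl])
    fix g assume g: "g \<in> {1..G}"
    then have "{T\<in>Pow P. T \<subseteq> prime_factors g} = Pow (prime_factors g)" using sub[OF g] by auto
    then show "1 / real (totient g) = (\<Sum>T\<in>{T\<in>Pow P. T \<subseteq> prime_factors g}. 1 / real g * w T)"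
      using inverse_totient_eq[of g] g by (simp add: w_def sum_distrib_left)
  qed
  also have "\<dots> = (\<Sum>T\<in>Pow P. \<Sum>g\<in>{g\<in>{1..G}. T \<subseteq> prime_factors g}. 1 / real g * w T)"
    using finP by (intro sum.swap_restrict) auto
  also have "\<dots> = (\<Sum>T\<in>Pow P. w T * (\<Sum>g\<in>{g\<in>{1..G}. T \<subseteq> prime_factors g}. 1 / real g))"
    by (simp add: sum_distrib_left)
  also have "\<dots> \<le> (\<Sum>T\<in>Pow P. w T * ((\<Prod>p\<in>T. 1 / real p) * (\<Sum>k=1..G. 1 / real k)))"
    by (intro sum_mono mult_left_mono inner w_nonneg) auto
  also have "\<dots> = (\<Sum>T\<in>Pow P. \<Prod>p\<in>T. 1 / (real p * (real p - 1))) * (\<Sum>k=1..G. 1 / real k)"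
  proof -
    have "w T * (\<Prod>p\<in>T. 1 / real p) = (\<Prod>p\<in>T. 1 / (real p * (real p - 1)))" for T
      by (simp add: w_def prod.distrib[symmetric] mult_ac)
    then show ?thesis
      by (subst sum_distrib_right) (simp only: mult.assoc[symmetric])
  qed
  also have "(\<Sum>T\<in>Pow P. \<Prod>p\<in>T. 1 / (real p * (real p - 1))) = (\<Prod>p\<in>P. 1 / (real p * (real p - 1)) + 1)"
    using finP by (simp add: prod_add)
  also have "\<dots> * (\<Sum>k=1..G. 1 / real k) \<le> exp 1 * (1 + ln (real G))"
    using prod_one_plus_pronic_inverse_le[of G] sum_inverse_le_one_plus_ln[OF G]
    by (intro mult_mono sum_nonneg) (auto simp: P_def add.commute)
  finally show ?thesis .
qed

text \<open>For \<open>g = gcd a b\<close> one has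
  \<open>totient (a * b) * totient g = totient a * totient b * g\<close>, and
  \<open>totient g \<le> g\<close>.\<close>

lemma totient_mult_le_totient: "totient a * totient b \<le> totient (a * b)"
proof (cases "gcd a b = 0")
  case False
  have "totient a * totient b * totient (gcd a b) \<le> totient a * totient b * gcd a b"
    by (intro mult_left_mono totient_le) simp
  also have "\<dots> = totient (a * b) * totient (gcd a b)"
    by (simp add: totient_gcd)
  finally show ?thesis using False totient_gt_0_iff[of "gcd a b"]
    by (simp only: mult_le_cancel2)
qed simp

lemma card_gcd_eq_lessThan:
  assumes n: "n > 0" and g: "g dvd n"
  shows "card {d\<in>{..<n}. gcd n d = g} = totient (n div g)"
proof -
  \<comment> \<open>The known count is over \<open>{0<..n}\<close>; as \<open>gcd n 0 = n\<close>,
    the residue 0 takes the place of \<open>n\<close>.\<close>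
  define f where "f = (\<lambda>d. if d = 0 then n else d)"
  have "bij_betw f {d\<in>{..<n}. gcd n d = g} {k\<in>{0<..n}. gcd k n = g}"
  proof (rule bij_betwI[where g = "\<lambda>k. if k = n then 0 else k"])
  qed (use n in \<open>auto simp: f_def gcd.commute split: if_splits\<close>)
  then show ?thesis
    using bij_betw_same_card[of f] card_gcd_eq_totient[OF n g] by simp
qed

lemma card_long_period_le:
  assumes n: "n > 0" and s: "0 < s" "s \<le> n"
  shows "real (card {d\<in>{..<n}. s \<le> n div gcd n d}) \<le> exp 1 * totient n * (1 + ln (real n / real s))"
proof -
  \<comment> \<open>A period of at least \<open>s\<close> means \<open>gcd n d \<le> G\<close>, so
    the steps are grouped by this gcd.\<close>
  define G where "G = n div s"
  have G: "G > 0" using s n by (simp add: G_def div_greater_zero_iff)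
  have "{d\<in>{..<n}. s \<le> n div gcd n d} \<subseteq> (\<Union>g\<in>{g\<in>{1..G}. g dvd n}. {d\<in>{..<n}. gcd n d = g})"
  proof
    fix d assume d: "d \<in> {d\<in>{..<n}. s \<le> n div gcd n d}"
    have gp: "gcd n d > 0" using n by simp
    have "s * gcd n d \<le> n" using d gp less_eq_div_iff_mult_less_eq[of "gcd n d" s n] by simp
    then have "gcd n d \<le> G" using s less_eq_div_iff_mult_less_eq[of s "gcd n d" n] by (simp add: G_def mult.commute)
    then show "d \<in> (\<Union>g\<in>{g\<in>{1..G}. g dvd n}. {d\<in>{..<n}. gcd n d = g})"
      using d gp by (auto simp: Suc_le_eq)
  qed
  then have "card {d\<in>{..<n}. s \<le> n div gcd n d} \<le> card (\<Union>g\<in>{g\<in>{1..G}. g dvd n}. {d\<in>{..<n}. gcd n d = g})"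
    by (intro card_mono) auto
  also have "\<dots> \<le> (\<Sum>g\<in>{g\<in>{1..G}. g dvd n}. card {d\<in>{..<n}. gcd n d = g})"
    by (intro card_UN_le) auto
  also have "\<dots> = (\<Sum>g\<in>{g\<in>{1..G}. g dvd n}. totient (n div g))"
    using n by (intro sum.cong card_gcd_eq_lessThan) auto
  finally have "real (card {d\<in>{..<n}. s \<le> n div gcd n d}) \<le> (\<Sum>g\<in>{g\<in>{1..G}. g dvd n}. real (totient (n div g)))"
    by (metis of_nat_le_iff of_nat_sum)
  also have "\<dots> \<le> (\<Sum>g\<in>{g\<in>{1..G}. g dvd n}. real (totient n) * (1 / totient g))"
  proof (rule sum_mono)
    fix g assume g: "g \<in> {g\<in>{1..G}. g dvd n}"
    have "totient g * totient (n div g) \<le> totient n"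
      using totient_mult_le_totient[of g "n div g"] g by simp
    then have "real (totient g) * real (totient (n div g)) \<le> real (totient n)"
      by (metis of_nat_le_iff of_nat_mult)
    moreover have "totient g > 0" using g by simp
    ultimately show "real (totient (n div g)) \<le> real (totient n) * (1 / totient g)"
      by (simp add: field_simps)
  qed
  also have "\<dots> \<le> (\<Sum>g=1..G. real (totient n) * (1 / totient g))"
    by (intro sum_mono2) auto
  also have "\<dots> = real (totient n) * (\<Sum>g=1..G. 1 / totient g)"
    by (simp add: sum_distrib_left)
  also have "\<dots> \<le> real (totient n) * (exp 1 * (1 + ln (real G)))"
    by (intro mult_left_mono sum_inverse_totient_le G) simp
  also have "\<dots> \<le> real (totient n) * (exp 1 * (1 + ln (real n / real s)))"
    using G s n by (intro mult_left_mono add_left_mono) (auto simp: G_def of_nat_div_le_of_nat)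
  finally show ?thesis by (simp add: mult_ac)
qed

section \<open>Dyadic blocks of orbits\<close>

lemma finite_pow2_le: "finite {i. 2 ^ i \<le> (m::nat)}"
proof (rule finite_subset)
  show "{i. 2 ^ i \<le> m} \<subseteq> {..m}" using less_exp le_trans less_imp_le by blast
qed simp

text \<open>Truncate \<open>t\<close> to multiples of growing powers of two. Consecutive truncations
  differ by nothing or by one block, according to a binary digit of \<open>t\<close>.\<close>

lemma dyadic_prefix_sum_le:
  fixes F :: "nat \<Rightarrow> real" and D :: "nat \<Rightarrow> real"
  assumes blocks: "\<And>i b. (b + 1) * 2 ^ i \<le> N \<Longrightarrow> \<bar>\<Sum>k\<in>{b * 2 ^ i..<(b + 1) * 2 ^ i}. F k\<bar> \<le> D i"
    and D: "\<And>i. D i \<ge> 0" and t: "t \<le> N"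
  shows "\<bar>\<Sum>k<t. F k\<bar> \<le> (\<Sum>i | 2 ^ i \<le> N. D i)"
proof -
  define P where "P = (\<lambda>t. \<Sum>k<t. F k)"
  define u where "u = (\<lambda>i. 2 ^ i * (t div 2 ^ i))"
  have step: "\<bar>P (u i) - P (u (Suc i))\<bar> \<le> (if 2 ^ i \<le> N then D i else 0)" for i
  proof -
    define q where "q = t div 2 ^ i"
    have uS: "u (Suc i) = 2 ^ i * (2 * (q div 2))"
      by (simp add: u_def q_def div_mult2_eq[symmetric] mult_ac)
    have ui: "u i = 2 ^ i * q" by (simp add: u_def q_def)
    show ?thesis
    proof (cases "even q")
      case True
      then show ?thesis using D[of i] by (simp add: uS ui)
    next
      case False
      define b where "b = 2 * (q div 2)"
      have b: "q = b + 1" using False by (simp add: b_def)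
      have le: "(b + 1) * 2 ^ i \<le> t" unfolding b[symmetric] q_def by (rule div_times_less_eq_dividend)
      have "{..<u i} = {..<u (Suc i)} \<union> {b * 2 ^ i..<(b + 1) * 2 ^ i}"
        unfolding uS ui b_def[symmetric] unfolding b by (auto simp: mult.commute)
      moreover have "{..<u (Suc i)} \<inter> {b * 2 ^ i..<(b + 1) * 2 ^ i} = {}"
        unfolding uS b_def[symmetric] by (auto simp: mult.commute)
      ultimately have "P (u i) = P (u (Suc i)) + (\<Sum>k\<in>{b * 2 ^ i..<(b + 1) * 2 ^ i}. F k)"
        unfolding P_def by (simp add: sum.union_disjoint)
      moreover have "2 ^ i \<le> N" using le t by (simp add: le_trans[of "2 ^ i" "(b + 1) * 2 ^ i"])
      ultimately show ?thesis using blocks[of b i] le t by simp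
    qed
  qed
  have "u 0 = t" by (simp add: u_def)
  \<comment> \<open>Since \<open>t < 2 ^ t\<close>, the telescoping sum may stop after
    \<open>t\<close> truncations.\<close>
  moreover have "u t = 0" by (simp add: u_def less_exp)
  ultimately have "P t = (\<Sum>i<t. P (u i) - P (u (Suc i)))"
    using sum_lessThan_telescope'[of "\<lambda>i. P (u i)" t] by (simp add: P_def)
  then have "\<bar>P t\<bar> \<le> (\<Sum>i<t. if 2 ^ i \<le> N then D i else 0)"
    using step by (simp add: order_trans[OF sum_abs sum_mono])
  also have "\<dots> = (\<Sum>i\<in>{i\<in>{..<t}. 2 ^ i \<le> N}. D i)"
    by (simp add: sum.If_cases Int_def)
  also have "\<dots> \<le> (\<Sum>i | 2 ^ i \<le> N. D i)"
    using D by (intro sum_mono2 finite_pow2_le) auto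
  finally show ?thesis by (simp add: P_def)
qed

section \<open>Orbits of a step and the progressions on them\<close>

lemma ap_terms_eq_dvd:
  fixes n r d j k :: nat
  assumes n: "n > 0" and eq: "(r + j * d) mod n = (r + k * d) mod n" and jk: "j \<le> k"
  shows "n div gcd n d dvd k - j"
proof -
  define g where "g = gcd n d"
  have g: "g > 0" using n by (simp add: g_def)
  obtain n' d' where n': "n = n' * g" "d = d' * g" "coprime n' d'"
    using gcd_coprime_exists[of n d] n unfolding g_def by (metis gcd_eq_0_iff less_irrefl)
  have "n dvd (r + k * d) - (r + j * d)"
    using eq jk mod_eq_dvd_iff_nat[of "r + j * d" "r + k * d" n] by (simp add: mult_right_mono)
  then have "n dvd (k - j) * d" using jk by (simp add: diff_mult_distrib)
  then have "n' dvd (k - j) * d'" using g n' by (simp add: mult.assoc[symmetric])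
  then have "n' dvd k - j" using n'(3) by (simp add: coprime_dvd_mult_left_iff)
  moreover have "n div gcd n d = n'" unfolding g_def[symmetric] using n'(1) g by (metis nonzero_mult_div_cancel_right less_irrefl)
  ultimately show ?thesis by simp
qed

lemma ap_term_periodic:
  fixes n r d k :: nat
  shows "(r + (k + n div gcd n d) * d) mod n = (r + k * d) mod n"
proof -
  have "(n div gcd n d) * d = n * (d div gcd n d)"
    by (metis div_mult_swap dvd_div_mult gcd_dvd1 gcd_dvd2)
  then have "r + (k + n div gcd n d) * d = (r + k * d) + n * (d div gcd n d)"
    by (simp add: distrib_right)
  then show ?thesis by (simp only: mod_mult_self2)
qed

lemma ap_terms_inj_on:
  fixes n r d j :: nat
  assumes "n > 0" "l \<le> n div gcd n d"
  shows "inj_on (\<lambda>k. (r + k * d) mod n) {j..<j + l}"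
proof (rule inj_onI)
  have *: "x = y" if "x \<in> {j..<j + l}" "y \<in> {j..<j + l}" "x \<le> y"
     "(r + x * d) mod n = (r + y * d) mod n" for x y
  proof -
    have "n div gcd n d dvd y - x" using ap_terms_eq_dvd assms that by blast
    moreover have "y - x < n div gcd n d" using that assms by auto
    ultimately show ?thesis using that(3) by (auto dest: dvd_imp_le)
  qed
  show "x = y" if "x \<in> {j..<j + l}" "y \<in> {j..<j + l}" "(r + x * d) mod n = (r + y * d) mod n" for x y
    using *[OF that(1,2) _ that(3)] *[OF that(2,1) _ that(3)[symmetric]] nat_le_linear by blast
qed

lemma ap_term_mod_gcd:
  fixes n r d k :: nat
  shows "((r + k * d) mod n) mod gcd n d = r mod gcd n d"
proof -
  have "((r + k * d) mod n) mod gcd n d = (r + k * d) mod gcd n d"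
    by (simp add: mod_mod_cancel)
  also have "\<dots> = r mod gcd n d"
    by (metis dvd_mult gcd_dvd2 mod_add_right_eq add_0_right dvd_imp_mod_0)
  finally show ?thesis .
qed

text \<open>By counting: one period has \<open>n div gcd n d\<close> distinct terms, all in one
  residue class modulo \<open>gcd n d\<close>, and that class has no more elements.\<close>

lemma ap_terms_cover:
  fixes n d a :: nat
  assumes n: "n > 0" and a: "a < n"
  shows "\<exists>k. a = (a mod gcd n d + k * d) mod n \<and> k < n div gcd n d"
proof -
  define g l r where "g = gcd n d" and "l = n div gcd n d" and "r = a mod gcd n d"
  have g: "g > 0" using n by (simp add: g_def)
  have gl: "n = g * l" unfolding g_def l_def by (rule dvd_mult_div_cancel[symmetric]) simp
  have rg: "r < g" using g by (simp add: r_def g_def)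
  define R where "R = {x\<in>{..<n}. x mod g = r}"
  have sub: "(\<lambda>k. (r + k * d) mod n) ` {0..<0 + l} \<subseteq> R"
    using n ap_term_mod_gcd[of r _ d n] rg by (auto simp: R_def g_def)
  have "R \<subseteq> (\<lambda>q. q * g + r) ` {..<l}"
  proof
    fix x assume "x \<in> R"
    then have x: "x < g * l" "x mod g = r" unfolding R_def gl by auto
    then have "x div g < l" by (simp add: less_mult_imp_div_less mult.commute)
    moreover have "x = (x div g) * g + r" using x(2) div_mult_mod_eq[of x g] by simp
    ultimately show "x \<in> (\<lambda>q. q * g + r) ` {..<l}" by blast
  qed
  then have "card R \<le> l" using surj_card_le[of "{..<l}" R] by simp
  moreover have "card ((\<lambda>k. (r + k * d) mod n) ` {0..<0 + l}) = l"
    using ap_terms_inj_on[OF n, of l d r 0] by (simp add: card_image l_def)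
  ultimately have "(\<lambda>k. (r + k * d) mod n) ` {0..<0 + l} = R"
    using sub by (intro card_seteq) (auto simp: R_def)
  moreover have "a \<in> R" using a by (simp add: R_def r_def g_def)
  ultimately have "a \<in> (\<lambda>k. (r + k * d) mod n) ` {0..<0 + l}" by simp
  then show ?thesis by (auto simp: l_def r_def)
qed

text \<open>Blocks are cut by rank within X and not by position on the orbit, so that the number of
  blocks of a given size is proportional to card X.\<close>

definition orbit_list :: "nat \<Rightarrow> nat set \<Rightarrow> nat \<Rightarrow> nat \<Rightarrow> nat list" where
  "orbit_list n X d r = filter (\<lambda>x. x \<in> X) (map (\<lambda>k. (r + k * d) mod n) [0..<n div gcd n d])"

lemma distinct_orbit_list: "n > 0 \<Longrightarrow> distinct (orbit_list n X d r)"
  using ap_terms_inj_on[of n "n div gcd n d" d r 0]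
  by (simp add: orbit_list_def distinct_map distinct_filter)

lemma set_orbit_list_subset: "set (orbit_list n X d r) \<subseteq> X"
  by (auto simp: orbit_list_def)

lemma length_orbit_list_le: "length (orbit_list n X d r) \<le> n div gcd n d"
  unfolding orbit_list_def by (rule order_trans[OF length_filter_le]) simp

text \<open>Different \<open>r < gcd n d\<close> give different residue classes modulo
  \<open>gcd n d\<close>, so the lists are disjoint parts of \<open>X\<close>.\<close>

lemma sum_length_orbit_list_le:
  assumes n: "n > 0" and X: "finite X"
  shows "(\<Sum>r<gcd n d. length (orbit_list n X d r)) \<le> card X"
proof -
  have mod: "x mod gcd n d = r mod gcd n d" if "x \<in> set (orbit_list n X d r)" for x r
    using that ap_term_mod_gcd[of r _ d n] by (auto simp: orbit_list_def)
  have "(\<Sum>r<gcd n d. length (orbit_list n X d r)) = (\<Sum>r<gcd n d. card (set (orbit_list n X d r)))"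
    using distinct_orbit_list[OF n] by (simp add: distinct_card)
  also have "\<dots> = card (\<Union>r<gcd n d. set (orbit_list n X d r))"
  proof (rule card_UN_disjoint[symmetric])
    show "\<forall>i\<in>{..<gcd n d}. \<forall>j\<in>{..<gcd n d}. i \<noteq> j \<longrightarrow> set (orbit_list n X d i) \<inter> set (orbit_list n X d j) = {}"
    proof (intro ballI impI)
      fix i j assume ij: "i \<in> {..<gcd n d}" "j \<in> {..<gcd n d}" "i \<noteq> j"
      have False if "x \<in> set (orbit_list n X d i)" "x \<in> set (orbit_list n X d j)" for x
        using mod[OF that(1)] mod[OF that(2)] ij by simp
      then show "set (orbit_list n X d i) \<inter> set (orbit_list n X d j) = {}" by blast
    qed
  qed auto
  also have "\<dots> \<le> card X"
    using set_orbit_list_subset by (intro card_mono X) blast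
  finally show ?thesis .
qed

text \<open>Along its orbit the progression occupies the positions \<open>k0..<k0 + l\<close>, with
  \<open>l\<close> at most the period. This is a difference of two prefixes, or, if it passes the
  end of the orbit, the full orbit plus one prefix minus another; hence the 3.\<close>

lemma ap_sum_le_prefix_sums:
  fixes c :: "nat \<Rightarrow> real"
  assumes n: "n > 0" and A: "A \<in> APs n"
    and prefix: "\<And>d r t. d < n \<Longrightarrow> r < gcd n d \<Longrightarrow> t \<le> length (orbit_list n X d r)
      \<Longrightarrow> \<bar>\<Sum>k<t. c (orbit_list n X d r ! k)\<bar> \<le> M"
  shows "\<bar>\<Sum>x\<in>A \<inter> X. c x\<bar> \<le> 3 * M"
proof -
  obtain a d l where A_eq: "A = arith_prog n a d l" and a: "a < n" and d: "d < n" and l: "l \<le> n div gcd n d"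
    using A unfolding APs_def Zn_def by auto
  define L r where "L = n div gcd n d" and "r = a mod gcd n d"
  have r: "r < gcd n d" using n by (simp add: r_def)
  obtain k0 where k0: "a = (r + k0 * d) mod n" "k0 < L"
    using ap_terms_cover[OF n a, of d] by (auto simp: r_def L_def)
  define e where "e = (\<lambda>k. (r + k * d) mod n)"
  define h where "h = (\<lambda>k. if e k \<in> X then c (e k) else 0)"
  define P where "P = (\<lambda>t. \<Sum>k<t. h k)"
  have e_per: "e (k + L) = e k" for k by (simp add: e_def L_def ap_term_periodic)
  have A_img: "A = e ` {k0..<k0 + l}"
  proof -
    have "(a + k * d) mod n = e (k0 + k)" for k
      unfolding e_def k0(1) mod_add_left_eq by (simp add: algebra_simps)
    then have "A = (\<lambda>k. e (k0 + k)) ` {0..<l}" by (auto simp: A_eq arith_prog_def)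
    also have "\<dots> = e ` ((\<lambda>k. k0 + k) ` {0..<l})" by (simp only: image_image)
    finally show ?thesis by (simp add: add.commute)
  qed
  have inj: "inj_on e {k0..<k0 + l}" unfolding e_def by (rule ap_terms_inj_on[OF n l])
  have sum_eq: "(\<Sum>x\<in>A \<inter> X. c x) = P (k0 + l) - P k0"
  proof -
    have "(\<Sum>x\<in>A \<inter> X. c x) = (\<Sum>x\<in>A. if x \<in> X then c x else 0)"
      unfolding A_img by (simp add: sum.inter_restrict)
    also have "\<dots> = (\<Sum>k\<in>{k0..<k0 + l}. h k)"
      unfolding A_img h_def using inj by (simp add: sum.reindex)
    also have "\<dots> = P (k0 + l) - P k0"
      unfolding P_def lessThan_atLeast0 using sum.atLeastLessThan_concat[of 0 k0 "k0 + l" h] by simp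
    finally show ?thesis .
  qed
  have P_le: "\<bar>P t\<bar> \<le> M" if t: "t \<le> L" for t
  proof -
    \<comment> \<open>Filtering the first \<open>t\<close> positions by \<open>X\<close> leaves an
      initial segment of the orbit list, which turns prefixes by position into prefixes by
      rank.\<close>
    define ys where "ys = filter (\<lambda>x. x \<in> X) (map e [0..<t])"
    have "[0..<L] = [0..<t] @ [t..<L]" using t upt_add_eq_append[of 0 t "L - t"] by simp
    then have xs: "orbit_list n X d r = ys @ filter (\<lambda>x. x \<in> X) (map e [t..<L])"
      by (simp add: orbit_list_def e_def[symmetric] L_def[symmetric] ys_def)
    have "P t = sum_list (map c ys)"
      unfolding ys_def
    proof (induction t)
      case (Suc t)
      then show ?case by (simp add: P_def h_def)
    qed (simp add: P_def)
    also have "\<dots> = (\<Sum>k<length ys. c (ys ! k))"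
      by (simp add: sum_list_sum_nth lessThan_atLeast0)
    also have "\<dots> = (\<Sum>k<length ys. c (orbit_list n X d r ! k))"
      by (intro sum.cong) (auto simp: xs nth_append)
    finally show ?thesis using prefix[OF d r, of "length ys"] by (simp add: xs)
  qed
  show ?thesis
  proof (cases "k0 + l \<le> L")
    case True
    then show ?thesis using sum_eq P_le[of "k0 + l"] P_le[of k0] k0(2) by linarith
  next
    case False
    define t where "t = k0 + l - L"
    have kl: "k0 + l = t + L" using False by (simp add: t_def)
    have "h (k + L) = h k" for k by (simp add: h_def e_per)
    then have "P (t + L) = P L + P t"
      unfolding P_def lessThan_atLeast0
      using sum.atLeastLessThan_concat[of 0 L "t + L" h] sum.shift_bounds_nat_ivl[of h 0 L t] by simp
    moreover have "t \<le> L" using k0(2) l by (simp add: t_def L_def)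
    ultimately show ?thesis using sum_eq P_le[of L] P_le[of t] P_le[of k0] k0(2) kl by simp
  qed
qed

section \<open>Blocks of orbit lists and their number\<close>

definition dyadic_block :: "'a list \<Rightarrow> nat \<Rightarrow> nat \<Rightarrow> 'a set" where
  "dyadic_block xs i b = (!) xs ` {b * 2 ^ i..<(b + 1) * 2 ^ i}"

lemma inj_on_nth_block:
  assumes "distinct xs" "(b + 1) * 2 ^ i \<le> length xs"
  shows "inj_on ((!) xs) {b * 2 ^ i..<(b + 1) * 2 ^ i}"
proof (rule inj_on_nth[OF assms(1)], rule ballI)
  fix k assume "k \<in> {b * 2 ^ i..<(b + 1) * 2 ^ i}"
  then have "k < (b + 1) * 2 ^ i" by (simp only: atLeastLessThan_iff)
  then show "k < length xs" using assms(2) by (rule less_le_trans)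
qed

lemma card_dyadic_block:
  assumes "distinct xs" "(b + 1) * 2 ^ i \<le> length xs"
  shows "card (dyadic_block xs i b) = 2 ^ i"
  using card_image[OF inj_on_nth_block[OF assms]] by (simp add: dyadic_block_def)

lemma dyadic_block_subset:
  assumes "(b + 1) * 2 ^ i \<le> length xs"
  shows "dyadic_block xs i b \<subseteq> set xs"
proof
  fix x assume "x \<in> dyadic_block xs i b"
  then obtain k where "x = xs ! k" "k < (b + 1) * 2 ^ i"
    unfolding dyadic_block_def by (metis atLeastLessThan_iff imageE)
  then show "x \<in> set xs" using assms nth_mem less_le_trans by blast
qed

text \<open>Every orbit list has length at most \<open>card X\<close>, which makes the range of
  scales independent of the step and the orbit.\<close>

lemma ap_sum_le_dyadic:
  fixes c :: "nat \<Rightarrow> real"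
  assumes n: "n > 0" and X: "finite X" and A: "A \<in> APs n" and D: "\<And>i. D i \<ge> 0"
    and blocks: "\<And>d r i b. d < n \<Longrightarrow> r < gcd n d \<Longrightarrow> (b + 1) * 2 ^ i \<le> length (orbit_list n X d r)
      \<Longrightarrow> \<bar>\<Sum>x\<in>dyadic_block (orbit_list n X d r) i b. c x\<bar> \<le> D i"
  shows "\<bar>\<Sum>x\<in>A \<inter> X. c x\<bar> \<le> 3 * (\<Sum>i | 2 ^ i \<le> card X. D i)"
proof (rule ap_sum_le_prefix_sums[OF n A])
  fix d r t
  assume d: "d < n" and r: "r < gcd n d" and t: "t \<le> length (orbit_list n X d r)"
  let ?xs = "orbit_list n X d r"
  have "length ?xs = card (set ?xs)" using distinct_orbit_list[OF n] by (simp add: distinct_card)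
  also have "\<dots> \<le> card X" by (intro card_mono X set_orbit_list_subset)
  finally have len: "length ?xs \<le> card X" .
  have "\<bar>\<Sum>k<t. c (?xs ! k)\<bar> \<le> (\<Sum>i | 2 ^ i \<le> length ?xs. D i)"
  proof (rule dyadic_prefix_sum_le[OF _ D t])
    fix i b assume le: "(b + 1) * 2 ^ i \<le> length ?xs"
    have "(\<Sum>k\<in>{b * 2 ^ i..<(b + 1) * 2 ^ i}. c (?xs ! k)) = (\<Sum>x\<in>dyadic_block ?xs i b. c x)"
      unfolding dyadic_block_def
      using inj_on_nth_block[OF distinct_orbit_list[OF n] le] by (simp add: sum.reindex)
    then show "\<bar>\<Sum>k\<in>{b * 2 ^ i..<(b + 1) * 2 ^ i}. c (?xs ! k)\<bar> \<le> D i"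
      using blocks[OF d r le] by simp
  qed
  also have "\<dots> \<le> (\<Sum>i | 2 ^ i \<le> card X. D i)"
    using len D by (intro sum_mono2 finite_pow2_le) auto
  finally show "\<bar>\<Sum>k<t. c (?xs ! k)\<bar> \<le> (\<Sum>i | 2 ^ i \<le> card X. D i)" .
qed

text \<open>Shorter orbits carry no block of size \<open>2 ^ i\<close>; stating this as a condition
  on \<open>d\<close> lets the count of long-period steps bound the first component. The last
  component numbers the full blocks.\<close>

definition block_indices :: "nat \<Rightarrow> nat set \<Rightarrow> nat \<Rightarrow> (nat \<times> nat \<times> nat) set" where
  "block_indices n X i = (SIGMA d:{d\<in>{..<n}. 2 ^ i \<le> n div gcd n d}.
     SIGMA r:{..<gcd n d}. {..<length (orbit_list n X d r) div 2 ^ i})"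

lemma finite_block_indices: "finite (block_indices n X i)"
  unfolding block_indices_def by (intro finite_SigmaI) auto

lemma card_block_indices_le:
  assumes n: "n > 0" and X: "finite X"
  shows "real (card (block_indices n X i)) \<le> card {d\<in>{..<n}. 2 ^ i \<le> n div gcd n d} * (card X / 2 ^ i)"
proof -
  have "real (card (block_indices n X i))
      = (\<Sum>d\<in>{d\<in>{..<n}. 2 ^ i \<le> n div gcd n d}. \<Sum>r<gcd n d. real (length (orbit_list n X d r) div 2 ^ i))"
    by (simp add: block_indices_def)
  also have "\<dots> \<le> (\<Sum>d\<in>{d\<in>{..<n}. 2 ^ i \<le> n div gcd n d}. card X / 2 ^ i)"
  proof (rule sum_mono)
    fix d
    have "(\<Sum>r<gcd n d. real (length (orbit_list n X d r) div 2 ^ i))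
       \<le> (\<Sum>r<gcd n d. real (length (orbit_list n X d r)) / 2 ^ i)"
      using of_nat_div_le_of_nat[of _ "2 ^ i", where 'a = real] by (intro sum_mono) simp
    also have "\<dots> = real (\<Sum>r<gcd n d. length (orbit_list n X d r)) / 2 ^ i"
      by (simp add: sum_divide_distrib)
    also have "\<dots> \<le> card X / 2 ^ i"
      using sum_length_orbit_list_le[OF n X, of d] by (intro divide_right_mono) (simp_all only: of_nat_le_iff, simp)
    finally show "(\<Sum>r<gcd n d. real (length (orbit_list n X d r) div 2 ^ i)) \<le> card X / 2 ^ i" .
  qed
  finally show ?thesis by simp
qed

section \<open>Iterated partial colouring\<close>

text \<open>The parameter a is the critical scale: there are fewer than card X blocks of size 2 ^ i when
  i is above a, and more when i is below a. The step size peaks at a and decays geometrically on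
  both sides.\<close>

definition step_size :: "nat \<Rightarrow> nat \<Rightarrow> real" where
  "step_size a i = (if i < a then 2 * (8 * 2 powr (real (a - i) / 4)) else 1 / 2 ^ (i - a)) * sqrt (2 ^ i)"

definition step_weight :: "nat \<Rightarrow> nat \<Rightarrow> int \<Rightarrow> real" where
  "step_weight a i = (if i < a then coarse_weight (8 * 2 powr (real (a - i) / 4)) else fine_weight (1 / 2 ^ (i - a)))"

text \<open>Entropy allowed per block: \<open>2 ^ 30 / u ^ 12\<close> at
  \<open>u = 8 * 2 powr (real (a - i) / 4)\<close>, and a bound for \<open>ln (1 / l) + 6\<close> at
  \<open>l = 1 / 2 ^ (i - a)\<close>, using \<open>ln 2 \<le> 1\<close>.\<close>

definition step_cost :: "nat \<Rightarrow> nat \<Rightarrow> real" where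
  "step_cost a i = (if i < a then 1 / (64 * 8 ^ (a - i)) else real (i - a) + 6)"

lemma step_size_pos: "step_size a i > 0"
  by (simp add: step_size_def)

lemma coarse_scale_ge: "8 * 2 powr (real k / 4) \<ge> (4::real)"
  using ge_one_powr_ge_zero[of 2 "real k / 4"] by simp

lemma step_weight_pos: "step_weight a i k > 0"
  by (simp add: step_weight_def coarse_weight_pos fine_weight_pos)

lemma sum_step_weight_le: "finite F \<Longrightarrow> (\<Sum>k\<in>F. step_weight a i k) \<le> 1"
  using sum_coarse_weight_le[OF coarse_scale_ge[of "a - i"], of F] sum_fine_weight_le[of "1 / 2 ^ (i - a)" F]
  by (cases "i < a") (auto simp: step_weight_def simp del: of_nat_diff)

lemma sum_step_cost_le:
  assumes X: "finite X" "S \<subseteq> X" and S: "card S = 2 ^ i"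
  shows "(\<Sum>A\<in>Pow X. - ln (step_weight a i (round (signed_sum A S / step_size a i)))) \<le> 2 ^ card X * step_cost a i"
proof -
  have ne: "S \<noteq> {}" using S by auto
  have sq: "sqrt (2 ^ i) = sqrt (real (card S))" by (simp add: S)
  show ?thesis
  proof (cases "i < a")
    case True
    define u :: real where "u = 8 * 2 powr (real (a - i) / 4)"
    have "u ^ 12 = 8 ^ 12 * (2 powr (real (a - i) / 4)) ^ 12"
      by (simp only: u_def power_mult_distrib)
    also have "(2 powr (real (a - i) / 4)) ^ 12 = 2 powr (real (3 * (a - i)))"
      by (simp add: powr_power)
    also have "\<dots> = 8 ^ (a - i)"
      by (subst powr_realpow) (simp_all add: power_mult)
    finally have "(2::real) ^ 30 / u ^ 12 = step_cost a i" using True by (simp add: step_cost_def)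
    moreover have "u \<ge> 4" unfolding u_def by (rule coarse_scale_ge)
    ultimately show ?thesis
      using sum_coarse_cost_le[OF X ne, of u] True
      unfolding step_weight_def step_size_def u_def[symmetric] sq by simp
  next
    case False
    define l :: real where "l = 1 / 2 ^ (i - a)"
    have l: "0 < l" "l \<le> 1" by (simp_all add: l_def)
    have "ln (1 / l) = real (i - a) * ln 2" by (simp add: l_def ln_realpow)
    also have "\<dots> \<le> real (i - a) * 1" using ln_le_minus_one[of "2::real"] by (intro mult_left_mono) auto
    finally have "ln (1 / l) + 6 \<le> step_cost a i" using False by (simp add: step_cost_def)
    then have "2 ^ card X * (ln (1 / l) + 6) \<le> 2 ^ card X * step_cost a i" by simp
    moreover have "(\<Sum>A\<in>Pow X. - ln (step_weight a i (round (signed_sum A S / step_size a i))))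
      \<le> 2 ^ card X * (ln (1 / l) + 6)"
      using sum_fine_cost_le[OF X ne l] False unfolding step_weight_def step_size_def l_def[symmetric] sq by simp
    ultimately show ?thesis by linarith
  qed
qed

text \<open>On naturals \<open>(i - a) + (a - i)\<close> is the distance of \<open>i\<close> and
  \<open>a\<close>, as one truncated difference vanishes. Each side of \<open>a\<close> gives a
  geometric series.\<close>

lemma sum_geometric_dist_le:
  fixes r :: real
  assumes r: "0 < r" "r < 1" and J: "finite J"
  shows "(\<Sum>i\<in>J. r ^ ((i - a) + (a - i))) \<le> 2 / (1 - r)"
proof -
  let ?f = "\<lambda>i. r ^ ((i - a) + (a - i))"
  have geo: "(\<Sum>k\<in>K. r ^ k) \<le> 1 / (1 - r)" if "finite K" for K
    using r that by (subst suminf_geometric[symmetric]) (auto intro!: sum_le_suminf summable_geometric)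
  let ?P = "{i\<in>J. a \<le> i}" and ?N = "{i\<in>J. i < a}"
  have "J = ?P \<union> ?N" by auto
  then have "(\<Sum>i\<in>J. ?f i) = (\<Sum>i\<in>?P. ?f i) + (\<Sum>i\<in>?N. ?f i)"
    using J by (subst sum.union_disjoint[symmetric]) auto
  also have "(\<Sum>i\<in>?P. ?f i) = (\<Sum>k\<in>(\<lambda>i. i - a) ` ?P. r ^ k)"
    by (subst sum.reindex) (auto simp: inj_on_def intro!: sum.cong)
  also have "(\<Sum>i\<in>?N. ?f i) = (\<Sum>k\<in>(\<lambda>i. a - i) ` ?N. r ^ k)"
    by (subst sum.reindex) (auto simp: inj_on_def intro!: sum.cong)
  also have "(\<Sum>k\<in>(\<lambda>i. i - a) ` ?P. r ^ k) + (\<Sum>k\<in>(\<lambda>i. a - i) ` ?N. r ^ k) \<le> 1 / (1 - r) + 1 / (1 - r)"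
    using J by (intro add_mono geo) auto
  finally show ?thesis by simp
qed

lemma quarter_power_le: "2 powr (- 1/4) \<le> (7/8 :: real)"
proof (rule power_le_imp_le_base)
  show "(2 powr (- 1/4)) ^ Suc 3 \<le> (7/8 :: real) ^ Suc 3"
  proof -
    have "(2 powr (- 1/4)) ^ Suc 3 = (1/2 :: real)"
      by (subst powr_power) (simp_all add: powr_minus)
    then show ?thesis by (simp add: power_divide)
  qed
qed simp

text \<open>Below \<open>a\<close> the excess factor eats half of the decay of
  \<open>sqrt (2 ^ i)\<close> and leaves the rate 1/4. Above \<open>a\<close> the decay has rate
  1/2, and is weakened to 1/4 for symmetry.\<close>

lemma step_size_le:
  "step_size a i \<le> 16 * sqrt (2 ^ a) * (2 powr (- 1/4)) ^ ((i - a) + (a - i))"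
proof -
  have sq: "sqrt (2 ^ k) = 2 powr (real k / 2)" for k
    by (simp add: powr_half_sqrt[symmetric] powr_powr powr_realpow[symmetric])
  have r: "(2 powr (- 1/4)) ^ k = (2::real) powr (- real k / 4)" for k
    by (simp add: powr_power mult.commute)
  show ?thesis
  proof (cases "i < a")
    case True
    then have "step_size a i = 16 * 2 powr (real (a - i) / 4 + real i / 2)"
      by (simp add: step_size_def sq powr_add)
    also have "real (a - i) / 4 + real i / 2 = real a / 2 + - real (a - i) / 4"
      using True by (simp add: of_nat_diff field_simps)
    also have "16 * 2 powr \<dots> = 16 * sqrt (2 ^ a) * (2 powr (- 1/4)) ^ (a - i)"
      unfolding sq r powr_add by simp
    finally show ?thesis using True by simp
  next
    case False
    have "step_size a i = 2 powr (- real (i - a) + real i / 2)"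
      using False unfolding powr_add powr_minus sq[symmetric]
      by (simp add: step_size_def powr_realpow inverse_eq_divide del: of_nat_diff)
    also have "- real (i - a) + real i / 2 = real a / 2 + - real (i - a) / 2"
      using False by (simp add: of_nat_diff field_simps)
    also have "2 powr \<dots> \<le> 2 powr (real a / 2 + - real (i - a) / 4)"
      by (intro powr_mono) auto
    also have "\<dots> = sqrt (2 ^ a) * (2 powr (- 1/4)) ^ (i - a)"
      unfolding sq r powr_add by simp
    also have "\<dots> \<le> 16 * (sqrt (2 ^ a) * (2 powr (- 1/4)) ^ (i - a))"
      by simp
    finally show ?thesis using False by simp
  qed
qed

text \<open>For \<open>y \<ge> 1\<close> the full two-sided series suffices. For
  \<open>y < 1\<close> all available scales lie below \<open>a\<close>, and the largest of them
  dominates with a term of order \<open>y\<close>.\<close>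

lemma sum_step_size_le:
  fixes a m :: nat
  assumes m: "m > 0"
  defines "y \<equiv> (real m / 2 ^ a) powr (1/4)"
  shows "(\<Sum>i | 2 ^ i \<le> m. step_size a i) \<le> 512 * sqrt (2 ^ a) * (y / (1 + y))"
proof -
  define x :: real where "x = 2 powr (- 1/4)"
  have x: "0 < x" "x < 1" "x \<le> 7/8" using quarter_power_le by (auto simp: x_def)
  have ypos: "y > 0" using m by (simp add: y_def)
  let ?J = "{i. 2 ^ i \<le> m}"
  have geo: "(\<Sum>i\<in>?J. x ^ ((i - k) + (k - i))) \<le> 16" for k
  proof -
    have "(\<Sum>i\<in>?J. x ^ ((i - k) + (k - i))) \<le> 2 / (1 - x)"
      by (rule sum_geometric_dist_le[OF x(1,2) finite_pow2_le])
    also have "\<dots> \<le> 16" using x by (simp add: field_simps)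
    finally show ?thesis .
  qed
  have main: "(\<Sum>i\<in>?J. x ^ ((i - a) + (a - i))) \<le> 32 * (y / (1 + y))"
  proof (cases "y \<ge> 1")
    case True
    then have "16 \<le> 32 * (y / (1 + y))" by (simp add: field_simps)
    then show ?thesis using geo[of a] by linarith
  next
    case False
    have "m < 2 ^ a"
    proof (rule ccontr)
      assume "\<not> m < 2 ^ a"
      then have "2 ^ a \<le> real m" by (metis not_less of_nat_le_iff of_nat_numeral of_nat_power)
      then have "y \<ge> 1" unfolding y_def by (intro ge_one_powr_ge_zero) auto
      then show False using False by simp
    qed
    define k where "k = Max ?J"
    have "?J \<noteq> {}" using m by (auto intro!: exI[of _ 0])
    then have k: "k \<in> ?J" "\<And>i. i \<in> ?J \<Longrightarrow> i \<le> k"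
      unfolding k_def using Max_in[OF finite_pow2_le] Max_ge[OF finite_pow2_le] by blast+
    have "(2::nat) ^ k < 2 ^ a" using k(1) le_less_trans[OF _ \<open>m < 2 ^ a\<close>] by blast
    then have ka: "k < a" by simp
    have xa: "x ^ (a - k) \<le> y"
    proof -
      have "x ^ (a - k) = (2 ^ k / 2 ^ a) powr (1/4)"
      proof -
        have "x ^ (a - k) = 2 powr (real (a - k) * (- 1/4))"
          by (simp add: x_def powr_power)
        also have "real (a - k) * (- 1/4) = (real k - real a) * (1/4)"
          using ka by (simp add: of_nat_diff field_simps)
        also have "2 powr ((real k - real a) * (1/4)) = (2 powr (real k - real a)) powr (1/4)" by (simp add: powr_powr)
        also have "2 powr (real k - real a) = (2 ^ k / 2 ^ a :: real)" by (simp add: powr_diff powr_realpow)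
        finally show ?thesis .
      qed
      also have "\<dots> \<le> y" unfolding y_def
      proof (intro powr_mono2 divide_right_mono)
        show "(2::real) ^ k \<le> real m" using k(1) by (metis mem_Collect_eq of_nat_le_iff of_nat_numeral of_nat_power)
      qed auto
      finally show ?thesis .
    qed
    \<comment> \<open>As \<open>i \<le> k < a\<close>, the distance to \<open>a\<close> splits at
      \<open>k\<close>, and the factor \<open>x ^ (a - k) \<le> y\<close> comes out.\<close>
    have "(\<Sum>i\<in>?J. x ^ ((i - a) + (a - i))) = (\<Sum>i\<in>?J. x ^ (a - k) * x ^ ((i - k) + (k - i)))"
      using k(2) ka by (intro sum.cong refl) (force simp flip: power_add)
    also have "\<dots> = x ^ (a - k) * (\<Sum>i\<in>?J. x ^ ((i - k) + (k - i)))" by (simp add: sum_distrib_left)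
    also have "\<dots> \<le> y * 16"
      using xa geo[of k] x ypos by (intro mult_mono sum_nonneg) auto
    also have "\<dots> \<le> 32 * (y / (1 + y))" using False ypos by (simp add: field_simps)
    finally show ?thesis .
  qed
  have "(\<Sum>i\<in>?J. step_size a i) \<le> (\<Sum>i\<in>?J. 16 * sqrt (2 ^ a) * x ^ ((i - a) + (a - i)))"
    unfolding x_def by (intro sum_mono step_size_le)
  also have "\<dots> = 16 * sqrt (2 ^ a) * (\<Sum>i\<in>?J. x ^ ((i - a) + (a - i)))" by (simp add: sum_distrib_left)
  also have "\<dots> \<le> 16 * sqrt (2 ^ a) * (32 * (y / (1 + y)))"
    using main by (intro mult_left_mono) auto
  finally show ?thesis by simp
qed

text \<open>The left side bounds the entropy per point of \<open>X\<close> spent at scale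
  \<open>i\<close>. As \<open>exp 1 \<le> 3\<close>, the constant 1024 leaves at most 1/256 block
  per point at scale \<open>a\<close>. At distance j below it, \<open>4 ^ j / 256\<close> blocks
  meet the cost \<open>1 / (64 * 8 ^ j)\<close>; above it, \<open>1 / (256 * 2 ^ j)\<close> blocks
  meet the cost \<open>j + 6\<close>.\<close>

lemma scale_budget_le:
  fixes n a i :: nat
  assumes n: "n > 0" and i: "2 ^ i \<le> n"
    and a: "1024 * real (totient n) * (1 + ln (real n / totient n)) \<le> 2 ^ a"
  shows "exp 1 * totient n * (1 + ln (real n / 2 ^ i)) / 2 ^ i * step_cost a i
     \<le> 6 / 256 * (3/4) ^ ((i - a) + (a - i))"
proof -
  define \<phi> where "\<phi> = real (totient n)"
  define L where "L = 1 + ln (real n / \<phi>)"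
  have \<phi>: "0 < \<phi>" "\<phi> \<le> n" "1 \<le> \<phi>"
    using n totient_le[of n] totient_gt_0_iff[of n] unfolding \<phi>_def by (auto simp del: totient_gt_0_iff)
  have L: "L \<ge> 1" unfolding L_def using \<phi> n by simp
  have a': "1024 * \<phi> * L \<le> 2 ^ a" using a by (simp add: \<phi>_def L_def)
  have "\<phi> * 1 \<le> 1024 * \<phi> * L" using \<phi> L by (intro mult_mono) auto
  then have \<phi>a: "\<phi> \<le> 2 ^ a" using a' by linarith
  have e\<phi>: "exp 1 * \<phi> * L \<le> 2 ^ a / 256"
  proof -
    have "exp 1 * \<phi> * L \<le> 3 * \<phi> * L" using exp_le \<phi> L by (intro mult_right_mono) auto
    moreover have "\<phi> * L \<ge> 0" using \<phi> L by simp
    ultimately show ?thesis using a' by linarith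
  qed
  have lna: "1 + ln (real n / 2 ^ a) \<le> L"
    unfolding L_def using \<phi> \<phi>a n by (intro add_left_mono ln_mono) (auto intro!: divide_left_mono)
  show ?thesis
  proof (cases "i < a")
    case True
    define j where "j = a - i"
    have ij: "(2::real) ^ a = 2 ^ i * 2 ^ j" using True by (simp add: j_def flip: power_add)
    have "ln (real n / 2 ^ i) = ln (real n / 2 ^ a * 2 ^ j)" unfolding ij by simp
    also have "\<dots> = ln (real n / 2 ^ a) + j * ln 2" using n by (subst ln_mult) (simp_all add: ln_realpow)
    also have "j * ln 2 \<le> j * (1::real)" using ln_le_minus_one[of "2::real"] by (intro mult_left_mono) auto
    \<comment> \<open>Descending \<open>j\<close> scales raises the logarithm by at most
      \<open>j\<close>. The crude bound \<open>L * 2 ^ j\<close> below is affordable because the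
      cost falls like \<open>8 ^ j\<close>.\<close>
    finally have "1 + ln (real n / 2 ^ i) \<le> L + j" using lna by simp
    also have "\<dots> \<le> L + L * j" using L by (simp add: mult_right_mono[of 1 L "real j", simplified])
    also have "\<dots> = L * (1 + j)" by (simp add: distrib_left)
    also have "\<dots> \<le> L * 2 ^ j"
    proof (rule mult_left_mono)
      have "1 + j \<le> 2 ^ j" using less_exp[of j] by linarith
      then show "real (1 + j) \<le> 2 ^ j" by (metis of_nat_le_iff of_nat_numeral of_nat_power)
    qed (use L in auto)
    finally have "exp 1 * \<phi> * (1 + ln (real n / 2 ^ i)) \<le> exp 1 * \<phi> * (L * 2 ^ j)"
      using \<phi> by (intro mult_left_mono) auto
    also have "\<dots> = exp 1 * \<phi> * L * 2 ^ j" by simp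
    also have "\<dots> \<le> 2 ^ a / 256 * 2 ^ j" using e\<phi> by (intro mult_right_mono) auto
    finally have "exp 1 * \<phi> * (1 + ln (real n / 2 ^ i)) / 2 ^ i * step_cost a i \<le> 2 ^ a / 256 * 2 ^ j / 2 ^ i * step_cost a i"
      by (intro mult_right_mono divide_right_mono) (auto simp: step_cost_def)
    also have "\<dots> = 2 ^ j * 2 ^ j / 256 / (64 * 8 ^ j)" using True by (simp add: ij step_cost_def j_def[symmetric])
    also have "\<dots> = 1 / 256 / 64 * (1/2) ^ j"
    proof -
      have "(8::real) ^ j = 2 ^ j * 2 ^ j * 2 ^ j" by (simp flip: power_mult_distrib)
      then show ?thesis by (simp add: power_divide)
    qed
    also have "\<dots> \<le> 6 / 256 * (3/4) ^ j"
      by (intro mult_mono power_mono) auto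
    finally show ?thesis using True by (simp add: \<phi>_def j_def)
  next
    case False
    define j where "j = i - a"
    have ij: "(2::real) ^ i = 2 ^ a * 2 ^ j" using False by (simp add: j_def flip: power_add)
    have "ln (real n / 2 ^ i) \<le> ln (real n / 2 ^ a)"
      using n False by (subst ln_le_cancel_iff) (auto intro!: divide_left_mono)
    then have "exp 1 * \<phi> * (1 + ln (real n / 2 ^ i)) \<le> exp 1 * \<phi> * L"
    proof (intro mult_left_mono)
      show "1 + ln (real n / 2 ^ i) \<le> L"
        using \<open>ln (real n / 2 ^ i) \<le> ln (real n / 2 ^ a)\<close> lna by linarith
    qed (use \<phi> in auto)
    then have "exp 1 * \<phi> * (1 + ln (real n / 2 ^ i)) \<le> 2 ^ a / 256" using e\<phi> by linarith
    then have "exp 1 * \<phi> * (1 + ln (real n / 2 ^ i)) / 2 ^ i * step_cost a i \<le> 2 ^ a / 256 / 2 ^ i * step_cost a i"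
      by (intro mult_right_mono divide_right_mono) (auto simp: step_cost_def)
    also have "\<dots> = 1 / 256 * (1/2) ^ j * (real j + 6)" using False by (simp add: ij step_cost_def j_def[symmetric] power_divide)
    also have "\<dots> \<le> 1 / 256 * (1/2) ^ j * (6 * (3/2) ^ j)"
    proof (rule mult_left_mono)
      have "1 + real j * (1/2) \<le> (1 + 1/2) ^ j" by (rule Bernoulli_inequality) simp
      then show "real j + 6 \<le> 6 * (3/2) ^ j" by simp
    qed simp
    also have "\<dots> = 6 / 256 * ((1/2) ^ j * (3/2) ^ j)" by simp
    also have "\<dots> = 6 / 256 * (3/4) ^ j" by (simp flip: power_mult_distrib)
    finally show ?thesis using False by (simp add: \<phi>_def j_def)
  qed
qed

lemma partial_colouring_APs:
  fixes n a :: nat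
  assumes n: "n > 0" and X: "X \<subseteq> Zn n" "X \<noteq> {}"
    and a: "1024 * real (totient n) * (1 + ln (real n / totient n)) \<le> 2 ^ a"
  defines "y \<equiv> (real (card X) / 2 ^ a) powr (1/4)"
  obtains c :: "nat \<Rightarrow> int" where "\<And>x. x \<in> X \<Longrightarrow> c x \<in> {-1, 0, 1}"
    "16 * card {x\<in>X. c x = 0} \<le> 15 * card X"
    "\<And>A. A \<in> APs n \<Longrightarrow> \<bar>real_of_int (\<Sum>x\<in>A \<inter> X. c x)\<bar> \<le> 1536 * sqrt (2 ^ a) * (y / (1 + y))"
proof -
  have finX: "finite X" using X finite_subset unfolding Zn_def by blast
  have cardX: "card X > 0" "card X \<le> n"
    using X finX card_mono[of "Zn n" X] by (auto simp: card_gt_0_iff Zn_def)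
  let ?J = "{i. 2 ^ i \<le> card X}"
  define I where "I = (SIGMA i:?J. block_indices n X i)"
  define S where "S = (\<lambda>(i, d, r, b). dyadic_block (orbit_list n X d r) i b)"
  have block: "S (i, d, r, b) \<subseteq> X \<and> card (S (i, d, r, b)) = 2 ^ i"
    if "(b + 1) * 2 ^ i \<le> length (orbit_list n X d r)" for i d r b
    using that dyadic_block_subset[OF that] set_orbit_list_subset[of n X d r] card_dyadic_block[OF distinct_orbit_list[OF n] that]
    by (auto simp: S_def)
  have mem_I: "(i, d, r, b) \<in> I \<longleftrightarrow> 2 ^ i \<le> card X \<and> d < n \<and> 2 ^ i \<le> n div gcd n d \<and> r < gcd n d
     \<and> (b + 1) * 2 ^ i \<le> length (orbit_list n X d r)" for i d r b
  proof -
    have "b < length (orbit_list n X d r) div 2 ^ i \<longleftrightarrow> (b + 1) * 2 ^ i \<le> length (orbit_list n X d r)"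
      using less_eq_div_iff_mult_less_eq[of "2 ^ i" "b + 1" "length (orbit_list n X d r)"]
      by (simp add: Suc_le_eq)
    then show ?thesis unfolding I_def block_indices_def mem_Sigma_iff by blast
  qed
  have SI: "S t \<subseteq> X \<and> card (S t) = 2 ^ fst t" if t: "t \<in> I" for t
  proof -
    obtain i d r b where tt: "t = (i, d, r, b)" by (metis prod_cases4)
    then show ?thesis using block[of b i d r] t mem_I[of i d r b] by (metis fst_conv)
  qed
  have finI: "finite I" unfolding I_def by (intro finite_SigmaI finite_pow2_le finite_block_indices)
  have "(\<Sum>t\<in>I. \<Sum>A\<in>Pow X. - ln (step_weight a (fst t) (round (signed_sum A (S t) / step_size a (fst t)))))
      \<le> (\<Sum>t\<in>I. 2 ^ card X * step_cost a (fst t))"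
    using SI by (intro sum_mono sum_step_cost_le finX) auto
  also have "\<dots> = (\<Sum>i\<in>?J. \<Sum>t\<in>block_indices n X i. 2 ^ card X * step_cost a i)"
    unfolding I_def by (subst sum.Sigma) (auto simp: finite_pow2_le finite_block_indices split_def)
  also have "\<dots> = (\<Sum>i\<in>?J. 2 ^ card X * (real (card (block_indices n X i)) * step_cost a i))"
    by (simp add: mult_ac)
  also have "\<dots> \<le> (\<Sum>i\<in>?J. 2 ^ card X * (card X * (6 / 256 * (3/4) ^ ((i - a) + (a - i)))))"
  proof (intro sum_mono mult_left_mono)
    fix i assume "i \<in> ?J"
    then have i: "2 ^ i \<le> n" using cardX by simp
    have "real (card (block_indices n X i)) \<le> card {d\<in>{..<n}. 2 ^ i \<le> n div gcd n d} * (card X / 2 ^ i)"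
      by (rule card_block_indices_le[OF n finX])
    also have "\<dots> \<le> exp 1 * totient n * (1 + ln (real n / real (2 ^ i))) * (card X / 2 ^ i)"
      using i by (intro mult_right_mono card_long_period_le n) auto
    also have "\<dots> = card X * (exp 1 * totient n * (1 + ln (real n / 2 ^ i)) / 2 ^ i)" by simp
    finally have "real (card (block_indices n X i)) * step_cost a i
      \<le> card X * (exp 1 * totient n * (1 + ln (real n / 2 ^ i)) / 2 ^ i) * step_cost a i"
      by (intro mult_right_mono) (auto simp: step_cost_def)
    also have "\<dots> = card X * (exp 1 * totient n * (1 + ln (real n / 2 ^ i)) / 2 ^ i * step_cost a i)"
      by (rule mult.assoc)
    also have "\<dots> \<le> card X * (6 / 256 * (3/4) ^ ((i - a) + (a - i)))"
      by (intro mult_left_mono scale_budget_le n i a) auto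
    finally show "real (card (block_indices n X i)) * step_cost a i \<le> card X * (6 / 256 * (3/4) ^ ((i - a) + (a - i)))" .
  qed simp
  also have "\<dots> = 2 ^ card X * (card X * (6 / 256 * (\<Sum>i\<in>?J. (3/4) ^ ((i - a) + (a - i)))))"
    unfolding sum_distrib_left ..
  \<comment> \<open>The geometric series is at most 8, so the total is 3/16 per point, within the
    budget of 1/4.\<close>
  also have "\<dots> \<le> 2 ^ card X * (card X * (6 / 256 * (2 / (1 - 3/4))))"
    by (intro mult_left_mono sum_geometric_dist_le finite_pow2_le) auto
  also have "\<dots> \<le> 2 ^ card X * (card X / 4)"
    by (intro mult_left_mono) auto
  finally have cost: "(\<Sum>t\<in>I. \<Sum>A\<in>Pow X. - ln (step_weight a (fst t) (round (signed_sum A (S t) / step_size a (fst t)))))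
      \<le> 2 ^ card X * (card X / 4)" .
  obtain c where c: "\<And>x. x \<in> X \<Longrightarrow> c x \<in> {-1, 0, 1}" "16 * card {x\<in>X. c x = 0} \<le> 15 * card X"
    "\<And>t. t \<in> I \<Longrightarrow> \<bar>real_of_int (\<Sum>x\<in>S t. c x)\<bar> \<le> step_size a (fst t)"
    by (rule partial_colouring[OF finX X(2) finI _ _ _ _ cost])
       (use SI step_size_pos step_weight_pos sum_step_weight_le in auto)
  show thesis
  proof
    fix A assume A: "A \<in> APs n"
    have "\<bar>\<Sum>x\<in>A \<inter> X. real_of_int (c x)\<bar> \<le> 3 * (\<Sum>i | 2 ^ i \<le> card X. step_size a i)"
    proof (rule ap_sum_le_dyadic[OF n finX A])
      fix d r i b assume dr: "d < n" "r < gcd n d" "(b + 1) * 2 ^ i \<le> length (orbit_list n X d r)"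
      have len: "2 ^ i \<le> length (orbit_list n X d r)"
        using dr(3) by (simp add: le_trans[of "2 ^ i" "(b + 1) * 2 ^ i"])
      have "2 ^ i \<le> card X" using block[OF dr(3)] card_mono[OF finX] by metis
      moreover have "2 ^ i \<le> n div gcd n d" using len length_orbit_list_le[of n X d r] by linarith
      ultimately have "(i, d, r, b) \<in> I" unfolding mem_I using dr by blast
      then show "\<bar>\<Sum>x\<in>dyadic_block (orbit_list n X d r) i b. real_of_int (c x)\<bar> \<le> step_size a i"
        using c(3)[of "(i, d, r, b)"] by (simp add: S_def)
    qed (simp add: less_imp_le[OF step_size_pos])
    also have "\<dots> \<le> 3 * (512 * sqrt (2 ^ a) * (y / (1 + y)))"
      unfolding y_def using sum_step_size_le[OF cardX(1), of a] by simp
    finally show "\<bar>real_of_int (\<Sum>x\<in>A \<inter> X. c x)\<bar> \<le> 1536 * sqrt (2 ^ a) * (y / (1 + y))" by simp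
  qed (use c in auto)
qed

text \<open>The potential ln (1 + (m / T) powr (1/4)) pays for one partial colouring of m points.\<close>

lemma potential_step:
  fixes T :: real and m m' :: nat
  assumes T: "T > 0" and m: "m > 0" and le: "16 * m' \<le> 15 * m"
  defines "y \<equiv> (real m / T) powr (1/4)"
  shows "1 / 64 * (y / (1 + y)) \<le> ln (1 + y) - ln (1 + (real m' / T) powr (1/4))"
proof -
  define y' where "y' = (real m' / T) powr (1/4)"
  have y: "y > 0" "y' \<ge> 0" using m T by (auto simp: y_def y'_def)
  have "y' \<le> (15/16 * (real m / T)) powr (1/4)"
    unfolding y'_def using T le by (intro powr_mono2) (auto simp: field_simps)
  also have "\<dots> = (15/16) powr (1/4) * y"
    unfolding y_def by (rule powr_mult)
  \<comment> \<open>The gap to 1 here is the 1/64 of the statement.\<close>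
  also have "(15/16) powr (1/4) \<le> (63/64 :: real)"
  proof (rule power_le_imp_le_base)
    show "((15/16) powr (1/4)) ^ Suc 3 \<le> (63/64 :: real) ^ Suc 3"
      by (simp add: powr_power power_divide)
  qed simp
  finally have y': "y' \<le> 63/64 * y" using y by simp
  have "1 / 64 * (y / (1 + y)) = (1/64 * y) / (1 + y)" by simp
  also have "\<dots> \<le> (y - y') / (1 + y)" using y y' by (intro divide_right_mono) auto
  also have "\<dots> = 1 - (1 + y') / (1 + y)" using y by (simp add: field_simps)
  also have "\<dots> \<le> - ln ((1 + y') / (1 + y))"
    using ln_le_minus_one[of "(1 + y') / (1 + y)"] y by simp
  also have "\<dots> = ln (1 + y) - ln (1 + y')" using y by (simp add: ln_div)
  finally show ?thesis by (simp add: y'_def)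
qed

text \<open>Induction on \<open>card X\<close>: one partial colouring, then a full colouring of the
  points still at 0. The drop of the potential pays for the new round.\<close>

lemma colouring_APs:
  fixes n a :: nat
  assumes n: "n > 0" and a: "1024 * real (totient n) * (1 + ln (real n / totient n)) \<le> 2 ^ a"
    and X: "X \<subseteq> Zn n"
  shows "\<exists>f\<in>colourings X. \<forall>A\<in>APs n.
    \<bar>real_of_int (\<Sum>x\<in>A \<inter> X. f x)\<bar> \<le> 98304 * sqrt (2 ^ a) * ln (1 + (real (card X) / 2 ^ a) powr (1/4))"
  using X
proof (induction "card X" arbitrary: X rule: less_induct)
  case less
  have finX: "finite X" using less.prems finite_subset unfolding Zn_def by blast
  show ?case
  proof (cases "X = {}")
    case True
    then show ?thesis by (intro bexI[of _ "\<lambda>_. 0"]) (auto simp: colourings_def)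
  next
    case False
    \<comment> \<open>\<open>98304 = 64 * 1536\<close>: the error constant of one round divided by
      the rate 1/64 of the potential.\<close>
    let ?K = "98304 * sqrt (2 ^ a)"
    define y where "y = (real (card X) / 2 ^ a) powr (1/4)"
    obtain c :: "nat \<Rightarrow> int" where c: "\<And>x. x \<in> X \<Longrightarrow> c x \<in> {-1, 0, 1}"
      "16 * card {x\<in>X. c x = 0} \<le> 15 * card X"
      "\<And>A. A \<in> APs n \<Longrightarrow> \<bar>real_of_int (\<Sum>x\<in>A \<inter> X. c x)\<bar> \<le> 1536 * sqrt (2 ^ a) * (y / (1 + y))"
      unfolding y_def using partial_colouring_APs[OF n less.prems False a] by blast
    define Y where "Y = {x\<in>X. c x = 0}"
    have cardX: "card X > 0" using False finX by (simp add: card_gt_0_iff)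
    have YX: "Y \<subseteq> X" by (auto simp: Y_def)
    have cY: "16 * card Y \<le> 15 * card X" using c(2) by (simp add: Y_def)
    then have "card Y < card X" using cardX by linarith
    then obtain f where f: "f \<in> colourings Y"
      "\<And>A. A \<in> APs n \<Longrightarrow> \<bar>real_of_int (\<Sum>x\<in>A \<inter> Y. f x)\<bar> \<le> ?K * ln (1 + (real (card Y) / 2 ^ a) powr (1/4))"
      using less.hyps[of Y] YX less.prems by blast
    \<comment> \<open>Exactly one summand is nonzero at each point of \<open>X\<close>:
      \<open>f\<close> vanishes off \<open>Y\<close> by the default value in
      \<open>colourings\<close>, and \<open>c\<close> vanishes on \<open>Y\<close>.\<close>
    define h where "h = (\<lambda>x. if x \<in> X then c x + f x else 0)"
    have hX: "h \<in> colourings X"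
      unfolding colourings_def
    proof (intro CollectI conjI ballI allI impI)
      fix x assume "x \<in> X"
      then show "h x \<in> {1, -1}"
        using f(1) c(1)[of x] by (cases "c x = 0") (auto simp: h_def colourings_def Y_def)
    qed (simp add: h_def)
    show ?thesis
    proof (intro bexI[of _ h] ballI hX)
      fix A assume A: "A \<in> APs n"
      have "(\<Sum>x\<in>A \<inter> X. h x) = (\<Sum>x\<in>A \<inter> X. c x) + (\<Sum>x\<in>A \<inter> X. f x)"
        unfolding sum.distrib[symmetric] by (intro sum.cong) (auto simp: h_def)
      also have "(\<Sum>x\<in>A \<inter> X. f x) = (\<Sum>x\<in>A \<inter> Y. f x)"
        using f(1) finX YX by (intro sum.mono_neutral_right) (auto simp: colourings_def)
      finally have "\<bar>real_of_int (\<Sum>x\<in>A \<inter> X. h x)\<bar>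
        \<le> 1536 * sqrt (2 ^ a) * (y / (1 + y)) + ?K * ln (1 + (real (card Y) / 2 ^ a) powr (1/4))"
        using c(3)[OF A] f(2)[OF A] by linarith
      also have "1536 * sqrt (2 ^ a) * (y / (1 + y)) = ?K * (1 / 64 * (y / (1 + y)))"
        using mult.assoc[of ?K "1 / 64" "y / (1 + y)"] by simp
      also have "\<dots> \<le> ?K * (ln (1 + y) - ln (1 + (real (card Y) / 2 ^ a) powr (1/4)))"
        unfolding y_def using potential_step[OF _ cardX cY, of "2 ^ a"] by (intro mult_left_mono) auto
      also have "\<dots> + ?K * ln (1 + (real (card Y) / 2 ^ a) powr (1/4)) = ?K * ln (1 + y)"
        by (simp add: right_diff_distrib)
      finally show "\<bar>real_of_int (\<Sum>x\<in>A \<inter> X. h x)\<bar> \<le> ?K * ln (1 + (real (card X) / 2 ^ a) powr (1/4))"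
        by (simp add: y_def)
    qed
  qed
qed

section \<open>From colourings to hereditary discrepancy\<close>

lemma finite_colourings:
  assumes "finite X"
  shows "finite (colourings X)"
proof (rule finite_subset)
  show "colourings X \<subseteq> {f. \<forall>x. (x \<in> X \<longrightarrow> f x \<in> {1, -1}) \<and> (x \<notin> X \<longrightarrow> f x = 0)}"
    by (auto simp: colourings_def)
qed (intro finite_set_of_finite_funs assms, simp)

lemma finite_APs: "finite (APs n)"
proof (rule finite_subset)
  show "APs n \<subseteq> Pow {..n}"
    by (auto simp: APs_def arith_prog_def Zn_def intro: less_imp_le mod_less_divisor)
qed simp

lemma herdisc_AP_le:
  fixes B :: real
  assumes n: "n > 0"
    and B: "\<And>X. X \<subseteq> Zn n \<Longrightarrow> \<exists>f\<in>colourings X. \<forall>A\<in>APs n. \<bar>real_of_int (\<Sum>x\<in>A \<inter> X. f x)\<bar> \<le> B"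
  shows "real_of_int (herdisc_AP n) \<le> B"
proof -
  have fin: "finite (Zn n)" by (simp add: Zn_def)
  have ne: "APs n \<noteq> {}" using n by (auto simp: APs_def Zn_def)
  have disc: "real_of_int (disc_restr n X) \<le> B" if X: "X \<subseteq> Zn n" for X
  proof -
    obtain f where f: "f \<in> colourings X" "\<And>A. A \<in> APs n \<Longrightarrow> \<bar>real_of_int (\<Sum>x\<in>A \<inter> X. f x)\<bar> \<le> B"
      using B[OF X] by blast
    let ?M = "\<lambda>f. Max ((\<lambda>A. \<bar>\<Sum>x\<in>A \<inter> X. f x\<bar>) ` APs n)"
    have "disc_restr n X \<le> ?M f"
      unfolding disc_restr_def using f(1) finite_colourings[OF finite_subset[OF X fin]]
      by (intro Min_le) auto
    moreover have "?M f \<in> (\<lambda>A. \<bar>\<Sum>x\<in>A \<inter> X. f x\<bar>) ` APs n"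
      using ne finite_APs by (intro Max_in) auto
    then obtain A where "A \<in> APs n" "?M f = \<bar>\<Sum>x\<in>A \<inter> X. f x\<bar>" by blast
    then have "real_of_int (?M f) \<le> B" using f(2)[of A] by simp
    ultimately show ?thesis by linarith
  qed
  have "herdisc_AP n \<in> disc_restr n ` Pow (Zn n)"
    unfolding herdisc_AP_def using fin by (intro Max_in) auto
  then show ?thesis using disc by auto
qed

lemma ex_power_of_two_between:
  fixes z :: real
  assumes "z \<ge> 1"
  shows "\<exists>a::nat. z \<le> 2 ^ a \<and> 2 ^ a \<le> 2 * z"
proof -
  define a where "a = (LEAST a. z \<le> 2 ^ a)"
  have "\<exists>a. z \<le> 2 ^ a" using real_arch_pow[of 2 z] less_imp_le by auto
  then have a: "z \<le> 2 ^ a" unfolding a_def by (rule LeastI_ex)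
  show ?thesis
  proof (cases a)
    case 0
    then show ?thesis using a assms by (intro exI[of _ a]) auto
  next
    case (Suc b)
    then have "\<not> z \<le> 2 ^ b" unfolding a_def by (metis lessI not_less_Least)
    then show ?thesis using a Suc by (intro exI[of _ a]) auto
  qed
qed

theorem theorem5p1:
  "\<exists>c::real. c > 0 \<and> (\<forall>n::nat. n > 0 \<longrightarrow>
     real_of_int (herdisc_AP n) \<le> c * sqrt (real (totient n)) * (ln (exp 1 * real n / real (totient n))) powr (3/2))"
proof (intro exI[of _ "98304 * sqrt 2048"] conjI allI impI)
  fix n :: nat assume n: "n > 0"
  define \<phi> where "\<phi> = real (totient n)"
  define L where "L = 1 + ln (real n / \<phi>)"
  have \<phi>: "0 < \<phi>" "\<phi> \<le> n" "1 \<le> \<phi>"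
    using n totient_le[of n] totient_gt_0_iff[of n] unfolding \<phi>_def by (auto simp del: totient_gt_0_iff)
  have L: "L \<ge> 1" unfolding L_def using \<phi> n by simp
  have "1 * 1 \<le> \<phi> * L" using \<phi> L by (intro mult_mono) auto
  \<comment> \<open>The lower bound on \<open>2 ^ a\<close> secures the entropy budget. The upper
    bound gives \<open>sqrt (2048 * (\<phi> * L))\<close>, the source of the constant and of the
    factor \<open>sqrt L\<close>.\<close>
  then obtain a where a: "1024 * \<phi> * L \<le> 2 ^ a" "2 ^ a \<le> 2048 * (\<phi> * L)"
    using ex_power_of_two_between[of "1024 * \<phi> * L"] by auto
  have "\<phi> * 1 \<le> 1024 * \<phi> * L" using \<phi> L by (intro mult_mono) auto
  then have \<phi>a: "\<phi> \<le> 2 ^ a" using a by linarith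
  \<comment> \<open>The potential supplies the remaining factor \<open>L\<close>: as
    \<open>\<phi> \<le> 2 ^ a\<close>, its argument is at most \<open>2 * (real n / \<phi>)\<close>,
    and 2 < e.\<close>
  have lnL: "ln (1 + (real m / 2 ^ a) powr (1/4)) \<le> L" if m: "m \<le> n" for m :: nat
  proof -
    have G: "1 \<le> real n / \<phi>" using \<phi> by simp
    have "(real m / 2 ^ a) powr (1/4) \<le> (real n / \<phi>) powr (1/4)"
      using m \<phi> \<phi>a by (intro powr_mono2 frac_le) auto
    also have "\<dots> \<le> (real n / \<phi>) powr 1" using G by (intro powr_mono) auto
    finally have "1 + (real m / 2 ^ a) powr (1/4) \<le> 2 * (real n / \<phi>)" using G by simp
    also have "\<dots> \<le> exp 1 * (real n / \<phi>)"
      using G exp_ge_add_one_self[of 1] by (intro mult_right_mono) auto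
    finally have "ln (1 + (real m / 2 ^ a) powr (1/4)) \<le> ln (exp 1 * (real n / \<phi>))"
      by (intro ln_mono) (auto intro: add_pos_nonneg)
    also have "\<dots> = ln (exp 1) + ln (real n / \<phi>)" using \<phi> n by (subst ln_mult) auto
    also have "\<dots> = L" by (simp add: L_def)
    finally show ?thesis .
  qed
  have "real_of_int (herdisc_AP n) \<le> 98304 * sqrt (2 ^ a) * L"
  proof (rule herdisc_AP_le[OF n])
    fix X assume X: "X \<subseteq> Zn n"
    then have "card X \<le> n" using card_mono[of "Zn n" X] by (simp add: Zn_def)
    then have "98304 * sqrt (2 ^ a) * ln (1 + (real (card X) / 2 ^ a) powr (1/4)) \<le> 98304 * sqrt (2 ^ a) * L"
      by (intro mult_left_mono lnL) auto
    moreover have "1024 * real (totient n) * (1 + ln (real n / totient n)) \<le> 2 ^ a"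
      using a(1) by (simp add: \<phi>_def L_def)
    ultimately show "\<exists>f\<in>colourings X. \<forall>A\<in>APs n. \<bar>real_of_int (\<Sum>x\<in>A \<inter> X. f x)\<bar> \<le> 98304 * sqrt (2 ^ a) * L"
      using colouring_APs[OF n _ X, of a] order_trans by meson
  qed
  also have "\<dots> \<le> 98304 * sqrt (2048 * (\<phi> * L)) * L"
    using a(2) L by (intro mult_right_mono mult_left_mono real_sqrt_le_mono) auto
  also have "\<dots> = 98304 * sqrt 2048 * sqrt \<phi> * (sqrt L * L)"
    by (simp add: real_sqrt_mult)
  also have "sqrt L * L = L powr (3/2)"
    using L powr_add[of L "1/2" 1] by (simp add: powr_half_sqrt)
  also have "L = ln (exp 1 * real n / real (totient n))"
    using \<phi> n by (simp add: L_def \<phi>_def ln_mult ln_div)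
  finally show "real_of_int (herdisc_AP n)
      \<le> 98304 * sqrt 2048 * sqrt (real (totient n)) * (ln (exp 1 * real n / real (totient n))) powr (3/2)"
    by (simp add: \<phi>_def)
qed simp

end
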